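(* Let $n>1$, let $\lambda\in\Bbbk$ be a primitive $n$th root of unity, let $H=H_n(\lambda)$ be the $n$th Taft algebra, and let $R$ be a left $H$-module algebra that is a domain. Suppose that the action of $H$ on $R$ is inner faithful and that no nontrivial power of $g$ (that is, no $g^i$ with $0<i<n$) is $X$-inner when restricted to $R^{\langle x\rangle}$. Then $\mathcal{Z}(R\# H)=\mathcal{Z}(R)\cap R^H$, where $R$ is identified with the subalgebra $R\#1$ of $R\#H$.
   Context: $\Bbbk$ is an algebraically closed field of characteristic zero; all algebras are $\Bbbk$-algebras; $\mathcal{Z}(R)$ denotes the center of $R$. The Taft algebra $H_n(\lambda)$ is the Hopf algebra generated by $g,x$ with relations $g^n=1$, $x^n=0$, $xg=\lambda gx$, and $\Delta(g)=g\otimes g$, $\Delta(x)=g\otimes x+x\otimes 1$, $\varepsilon(g)=1$, $\varepsilon(x)=0$, $S(g)=g^{n-1}$, $S(x)=-g^{n-1}x$. $R$ is a left $H$-module algebra ($H$ acts on $R$) if $R$ is a left $H$-module with $h\cdot 1_R=\varepsilon(h)1_R$ and $h\cdot(rr')=\sum(h_1\cdot r)(h_2\cdot r')$. The action is inner faithful if no nonzero Hopf ideal of $H$ annihilates $R$. The smash product $R\#H$ is $R\otimes H$ as a vector space, with elements $r\#h$ and multiplication $(r\#h)(r'\#h')=\sum r(h_1\cdot r')\#h_2h'$. $R^{\langle x\rangle}=\{r\in R: x(r)=0\}$ (a $g$-stable subalgebra of $R$), and $R^H=\{r\in R: h(r)=\varepsilon(h)r\ \text{for all }h\in H\}$. An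 automorphism $\sigma$ of a domain $D$ is $X$-inner if there exists a nonzero $a\in D$ such that $ra=a\sigma(r)$ for all $r\in D$. *)

theory Defs
  imports
    "HOL-Computational_Algebra.Computational_Algebra"
    "HOL-Library.Poly_Mapping"
begin

section \<open>Free vector spaces\<close>

text \<open>The free \<open>'k\<close>-vector space on \<open>'i\<close> is the type of finitely supported functions
  \<open>'i \<Rightarrow>\<^sub>0 'k\<close>; the basis vector of \<open>i\<close> is \<open>Poly_Mapping.single i 1\<close>.\<close>

definition fscale :: "'k::field \<Rightarrow> ('i \<Rightarrow>\<^sub>0 'k) \<Rightarrow> ('i \<Rightarrow>\<^sub>0 'k)" where
  "fscale c p = Poly_Mapping.map ((*) c) p"

lemma lookup_fscale [simp]:
  "Poly_Mapping.lookup (fscale c p) i = c * Poly_Mapping.lookup p i"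
  by (simp add: fscale_def Poly_Mapping.map.rep_eq when_def)

global_interpretation fspace: vector_space "fscale :: 'k::field \<Rightarrow> ('i \<Rightarrow>\<^sub>0 'k) \<Rightarrow> ('i \<Rightarrow>\<^sub>0 'k)"
  by standard (auto intro!: poly_mapping_eqI simp: lookup_add algebra_simps)

abbreviation basis_vec :: "'i \<Rightarrow> ('i \<Rightarrow>\<^sub>0 'k::field)" where
  "basis_vec i \<equiv> Poly_Mapping.single i 1"

text \<open>The linear extension of \<open>f\<close>, for a target space with scalar multiplication \<open>s\<close>.\<close>

definition lin_ext :: "('k::field \<Rightarrow> 'c \<Rightarrow> 'c) \<Rightarrow> ('i \<Rightarrow> 'c) \<Rightarrow> ('i \<Rightarrow>\<^sub>0 'k) \<Rightarrow> 'c::ab_group_add" where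
  "lin_ext s f p = (\<Sum>i\<in>Poly_Mapping.keys p. s (Poly_Mapping.lookup p i) (f i))"


section \<open>Tensor products\<close>

text \<open>\<open>A \<otimes> B\<close> is the quotient of the free vector space on \<open>A \<times> B\<close> by the subspace spanned by
  the bilinearity relators, its elements being equivalence classes.\<close>

definition tensor_null ::
  "('k::field \<Rightarrow> 'a \<Rightarrow> 'a::ab_group_add) \<Rightarrow> ('k \<Rightarrow> 'b \<Rightarrow> 'b::ab_group_add) \<Rightarrow> ('a \<times> 'b \<Rightarrow>\<^sub>0 'k) set" where
  "tensor_null sA sB = fspace.span
     ({basis_vec (a + a', b) - basis_vec (a, b) - basis_vec (a', b) | a a' b. True} \<union>
      {basis_vec (a, b + b') - basis_vec (a, b) - basis_vec (a, b') | a b b'. True} \<union>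
      {basis_vec (sA c a, b) - fscale c (basis_vec (a, b)) | c a b. True} \<union>
      {basis_vec (a, sB c b) - fscale c (basis_vec (a, b)) | c a b. True})"

definition tensor_rel ::
  "('k::field \<Rightarrow> 'a \<Rightarrow> 'a::ab_group_add) \<Rightarrow> ('k \<Rightarrow> 'b \<Rightarrow> 'b::ab_group_add) \<Rightarrow> ('a \<times> 'b \<Rightarrow>\<^sub>0 'k) rel" where
  "tensor_rel sA sB = {(p, q). p - q \<in> tensor_null sA sB}"

definition tensor ::
  "('k::field \<Rightarrow> 'a \<Rightarrow> 'a::ab_group_add) \<Rightarrow> ('k \<Rightarrow> 'b \<Rightarrow> 'b::ab_group_add) \<Rightarrow> ('a \<times> 'b \<Rightarrow>\<^sub>0 'k) set set" where
  "tensor sA sB = UNIV // tensor_rel sA sB"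

definition tcls ::
  "('k::field \<Rightarrow> 'a \<Rightarrow> 'a::ab_group_add) \<Rightarrow> ('k \<Rightarrow> 'b \<Rightarrow> 'b::ab_group_add)
    \<Rightarrow> ('a \<times> 'b \<Rightarrow>\<^sub>0 'k) \<Rightarrow> ('a \<times> 'b \<Rightarrow>\<^sub>0 'k) set" where
  "tcls sA sB p = tensor_rel sA sB `` {p}"

abbreviation tens ::
  "('k::field \<Rightarrow> 'a \<Rightarrow> 'a::ab_group_add) \<Rightarrow> ('k \<Rightarrow> 'b \<Rightarrow> 'b::ab_group_add)
    \<Rightarrow> 'a \<Rightarrow> 'b \<Rightarrow> ('a \<times> 'b \<Rightarrow>\<^sub>0 'k) set" where
  "tens sA sB a b \<equiv> tcls sA sB (basis_vec (a, b))"

text \<open>A representative of a tensor, i.e. an expression of it as a finite sum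
  \<open>\<Sum> c\<^sub>i (a\<^sub>i \<otimes> b\<^sub>i)\<close>. All uses below are through (multi)linear extensions, so that the result
  does not depend on the choice: see \<open>lin_ext_tensor_rel\<close>.\<close>

definition rep :: "'t set \<Rightarrow> 't" where
  "rep T = (SOME p. p \<in> T)"

definition bilinear_map ::
  "('k::field \<Rightarrow> 'a \<Rightarrow> 'a::ab_group_add) \<Rightarrow> ('k \<Rightarrow> 'b \<Rightarrow> 'b::ab_group_add)
    \<Rightarrow> ('k \<Rightarrow> 'c \<Rightarrow> 'c::ab_group_add) \<Rightarrow> ('a \<Rightarrow> 'b \<Rightarrow> 'c) \<Rightarrow> bool" where
  "bilinear_map sA sB sC f \<longleftrightarrow>
     (\<forall>a a' b. f (a + a') b = f a b + f a' b) \<and> (\<forall>a b b'. f a (b + b') = f a b + f a b') \<and>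
     (\<forall>c a b. f (sA c a) b = sC c (f a b)) \<and> (\<forall>c a b. f a (sB c b) = sC c (f a b))"

lemma equiv_tensor_rel: "equiv UNIV (tensor_rel sA sB)"
proof (rule equivI)
  show "refl (tensor_rel sA sB)"
    by (auto simp: refl_on_def tensor_rel_def tensor_null_def fspace.span_zero)
  show "sym (tensor_rel sA sB)"
    unfolding sym_def tensor_rel_def tensor_null_def
    using fspace.span_neg by fastforce
  show "trans (tensor_rel sA sB)"
    unfolding trans_def tensor_rel_def tensor_null_def
    using fspace.span_add by fastforce
qed auto

lemma lin_ext_superset:
  assumes "vector_space s" "finite A" "Poly_Mapping.keys p \<subseteq> A"
  shows "lin_ext s f p = (\<Sum>i\<in>A. s (Poly_Mapping.lookup p i) (f i))"
proof -
  interpret vector_space s by fact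
  show ?thesis
    unfolding lin_ext_def
    by (rule sum.mono_neutral_left) (use assms(2,3) in \<open>auto simp: in_keys_iff\<close>)
qed

lemma module_hom_lin_ext:
  fixes s :: "'k::field \<Rightarrow> 'c \<Rightarrow> 'c::ab_group_add" and f :: "'i \<Rightarrow> 'c"
  assumes "vector_space s"
  shows "module_hom fscale s (lin_ext s f)"
proof -
  interpret vector_space s by fact
  show ?thesis
  proof
    fix p q :: "'i \<Rightarrow>\<^sub>0 'k"
    let ?A = "Poly_Mapping.keys p \<union> Poly_Mapping.keys q"
    have "Poly_Mapping.keys (p + q) \<subseteq> ?A" by (rule keys_add)
    then show "lin_ext s f (p + q) = lin_ext s f p + lin_ext s f q"
      by (simp add: lin_ext_superset[OF assms, of ?A] lookup_add scale_left_distrib sum.distrib)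
  next
    fix c and p :: "'i \<Rightarrow>\<^sub>0 'k"
    have "Poly_Mapping.keys (fscale c p) \<subseteq> Poly_Mapping.keys p"
      by (auto simp: in_keys_iff)
    then show "lin_ext s f (fscale c p) = s c (lin_ext s f p)"
      by (simp add: lin_ext_superset[OF assms, of "Poly_Mapping.keys p"] scale_sum_right)
  qed
qed

lemma lin_ext_basis_vec [simp]:
  assumes "vector_space s"
  shows "lin_ext s f (basis_vec i) = f i"
proof -
  interpret vector_space s by fact
  show ?thesis by (simp add: lin_ext_def)
qed

lemma lin_ext_tensor_rel:
  assumes "vector_space sC" "bilinear_map sA sB sC f" "(p, q) \<in> tensor_rel sA sB"
  shows "lin_ext sC (\<lambda>(a, b). f a b) p = lin_ext sC (\<lambda>(a, b). f a b) q"
proof -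
  let ?L = "lin_ext sC (\<lambda>(a, b). f a b)"
  interpret L: module_hom fscale sC ?L by (rule module_hom_lin_ext) fact
  have "?L z = 0" if "z \<in> tensor_null sA sB" for z
    by (rule L.eq_0_on_span[OF _ that[unfolded tensor_null_def]])
       (use assms(2) in \<open>auto simp: L.diff L.scale assms(1) bilinear_map_def\<close>)
  then show ?thesis
    using assms(3) by (simp add: tensor_rel_def eq_iff_diff_eq_0[of "?L p"] flip: L.diff)
qed

definition tensor3_null ::
  "('k::field \<Rightarrow> 'a \<Rightarrow> 'a::ab_group_add) \<Rightarrow> ('a \<times> 'a \<times> 'a \<Rightarrow>\<^sub>0 'k) set" where
  "tensor3_null s = fspace.span
     ({basis_vec (a + a', b, d) - basis_vec (a, b, d) - basis_vec (a', b, d) | a a' b d. True} \<union>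
      {basis_vec (a, b + b', d) - basis_vec (a, b, d) - basis_vec (a, b', d) | a b b' d. True} \<union>
      {basis_vec (a, b, d + d') - basis_vec (a, b, d) - basis_vec (a, b, d') | a b d d'. True} \<union>
      {basis_vec (s c a, b, d) - fscale c (basis_vec (a, b, d)) | c a b d. True} \<union>
      {basis_vec (a, s c b, d) - fscale c (basis_vec (a, b, d)) | c a b d. True} \<union>
      {basis_vec (a, b, s c d) - fscale c (basis_vec (a, b, d)) | c a b d. True})"

definition tadd where
  "tadd sA sB P Q = tcls sA sB (rep P + rep Q)"

definition tscale where
  "tscale sA sB c P = tcls sA sB (fscale c (rep P))"

text \<open>The algebra structure of \<open>A \<otimes> A\<close>: \<open>(a \<otimes> b) (a' \<otimes> b') = a a' \<otimes> b b'\<close>.\<close>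

definition tmult ::
  "('k::field \<Rightarrow> 'a \<Rightarrow> 'a::ring_1) \<Rightarrow> ('a \<times> 'a \<Rightarrow>\<^sub>0 'k) set \<Rightarrow> ('a \<times> 'a \<Rightarrow>\<^sub>0 'k) set \<Rightarrow> ('a \<times> 'a \<Rightarrow>\<^sub>0 'k) set" where
  "tmult s P Q = tcls s s
     (lin_ext fscale (\<lambda>(a, b). lin_ext fscale (\<lambda>(a', b'). basis_vec (a * a', b * b')) (rep Q)) (rep P))"


section \<open>Algebras and Hopf algebras\<close>

locale k_algebra = vector_space scale
  for scale :: "'k::field \<Rightarrow> 'a::ring_1 \<Rightarrow> 'a" +
  assumes scale_mult_left: "scale c (a * b) = scale c a * b"
    and scale_mult_right: "scale c (a * b) = a * scale c b"

text \<open>Below \<open>lin_ext s (\<lambda>(h1, h2). f h1 h2) (rep (\<Delta> h))\<close> is the Sweedler sum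
  \<open>\<Sum> f h\<^sub>1 h\<^sub>2\<close>.\<close>

locale hopf_algebra = k_algebra sH
  for sH :: "'k::field \<Rightarrow> 'h::ring_1 \<Rightarrow> 'h" +
  fixes \<Delta> :: "'h \<Rightarrow> ('h \<times> 'h \<Rightarrow>\<^sub>0 'k) set"
    and \<epsilon> :: "'h \<Rightarrow> 'k"
    and S :: "'h \<Rightarrow> 'h"
  assumes comult_tensor: "\<Delta> h \<in> tensor sH sH"
    and comult_add: "\<Delta> (h + h') = tadd sH sH (\<Delta> h) (\<Delta> h')"
    and comult_scale: "\<Delta> (sH c h) = tscale sH sH c (\<Delta> h)"
    and comult_one: "\<Delta> 1 = tens sH sH 1 1"
    and comult_mult: "\<Delta> (h * h') = tmult sH (\<Delta> h) (\<Delta> h')"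
    and counit_add: "\<epsilon> (h + h') = \<epsilon> h + \<epsilon> h'"
    and counit_scale: "\<epsilon> (sH c h) = c * \<epsilon> h"
    and counit_one: "\<epsilon> 1 = 1"
    and counit_mult: "\<epsilon> (h * h') = \<epsilon> h * \<epsilon> h'"
    and antipode_add: "S (h + h') = S h + S h'"
    and antipode_scale: "S (sH c h) = sH c (S h)"
    and coassoc:
      "lin_ext fscale (\<lambda>(h1, h2).
          lin_ext fscale (\<lambda>(h11, h12). basis_vec (h11, h12, h2)) (rep (\<Delta> h1))) (rep (\<Delta> h))
       - lin_ext fscale (\<lambda>(h1, h2).
          lin_ext fscale (\<lambda>(h21, h22). basis_vec (h1, h21, h22)) (rep (\<Delta> h2))) (rep (\<Delta> h))
       \<in> tensor3_null sH"
    and counit_left: "lin_ext sH (\<lambda>(h1, h2). sH (\<epsilon> h1) h2) (rep (\<Delta> h)) = h"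
    and counit_right: "lin_ext sH (\<lambda>(h1, h2). sH (\<epsilon> h2) h1) (rep (\<Delta> h)) = h"
    and antipode_left: "lin_ext sH (\<lambda>(h1, h2). S h1 * h2) (rep (\<Delta> h)) = sH (\<epsilon> h) 1"
    and antipode_right: "lin_ext sH (\<lambda>(h1, h2). h1 * S h2) (rep (\<Delta> h)) = sH (\<epsilon> h) 1"

definition two_sided_ideal :: "'h::ring_1 set \<Rightarrow> bool" where
  "two_sided_ideal I \<longleftrightarrow>
     0 \<in> I \<and> (\<forall>a\<in>I. \<forall>b\<in>I. a + b \<in> I) \<and> (\<forall>a. \<forall>b\<in>I. a * b \<in> I \<and> b * a \<in> I)"

text \<open>The condition on \<open>\<Delta>\<close> is \<open>\<Delta> I \<subseteq> I \<otimes> H + H \<otimes> I\<close>.\<close>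

definition hopf_ideal ::
  "('k::field \<Rightarrow> 'h::ring_1 \<Rightarrow> 'h) \<Rightarrow> ('h \<Rightarrow> ('h \<times> 'h \<Rightarrow>\<^sub>0 'k) set) \<Rightarrow> ('h \<Rightarrow> 'k) \<Rightarrow> ('h \<Rightarrow> 'h)
    \<Rightarrow> 'h set \<Rightarrow> bool" where
  "hopf_ideal sH \<Delta> \<epsilon> S I \<longleftrightarrow>
     two_sided_ideal I \<and>
     (\<forall>h\<in>I. \<Delta> h \<in> tcls sH sH ` fspace.span {basis_vec (a, b) | a b. a \<in> I \<or> b \<in> I}) \<and>
     (\<forall>h\<in>I. \<epsilon> h = 0) \<and>
     S ` I \<subseteq> I"


section \<open>Taft algebras\<close>

definition primitive_root :: "nat \<Rightarrow> 'k::field \<Rightarrow> bool" where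
  "primitive_root n c \<longleftrightarrow> n > 0 \<and> c ^ n = 1 \<and> (\<forall>m. 0 < m \<and> m < n \<longrightarrow> c ^ m \<noteq> 1)"

text \<open>The free algebra on two generators is the free vector space on the words in two letters.
  The two-sided ideal generated by the Taft relators \<open>r\<close> is spanned by the elements \<open>u r v\<close>
  with \<open>u\<close>, \<open>v\<close> words.\<close>

datatype letter = Letter_g | Letter_x

definition word_eval :: "'h::ring_1 \<Rightarrow> 'h \<Rightarrow> letter list \<Rightarrow> 'h" where
  "word_eval g x w = prod_list (map (case_letter g x) w)"

definition taft_ideal :: "nat \<Rightarrow> 'k::field \<Rightarrow> (letter list \<Rightarrow>\<^sub>0 'k) set" where
  "taft_ideal n lam = fspace.span
     ({basis_vec (u @ replicate n Letter_g @ v) - basis_vec (u @ v) | u v. True} \<union>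
      {basis_vec (u @ replicate n Letter_x @ v) | u v. True} \<union>
      {basis_vec (u @ [Letter_x, Letter_g] @ v) - fscale lam (basis_vec (u @ [Letter_g, Letter_x] @ v))
        | u v. True})"

locale taft_algebra = hopf_algebra sH \<Delta> \<epsilon> S
  for n :: nat and lam :: "'k::field"
    and sH :: "'k \<Rightarrow> 'h::ring_1 \<Rightarrow> 'h" and \<Delta> \<epsilon> S
    and g x :: 'h +
  assumes generated: "range (lin_ext sH (word_eval g x)) = UNIV"
    and presented: "{p. lin_ext sH (word_eval g x) p = 0} = taft_ideal n lam"
    and comult_g: "\<Delta> g = tens sH sH g g"
    and comult_x: "\<Delta> x = tadd sH sH (tens sH sH g x) (tens sH sH x 1)"
    and counit_g: "\<epsilon> g = 1"
    and counit_x: "\<epsilon> x = 0"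
    and antipode_g: "S g = g ^ (n - 1)"
    and antipode_x: "S x = - (g ^ (n - 1) * x)"


section \<open>Actions and smash products\<close>

locale module_algebra = hopf_algebra sH \<Delta> \<epsilon> S + R: k_algebra sR
  for sH :: "'k::field \<Rightarrow> 'h::ring_1 \<Rightarrow> 'h" and \<Delta> \<epsilon> S
    and sR :: "'k \<Rightarrow> 'r::ring_1 \<Rightarrow> 'r" +
  fixes act :: "'h \<Rightarrow> 'r \<Rightarrow> 'r"
  assumes act_bilinear: "bilinear_map sH sR sR act"
    and act_one: "act 1 r = r"
    and act_mult: "act (h * h') r = act h (act h' r)"
    and act_unit: "act h 1 = sR (\<epsilon> h) 1"
    and act_prod: "act h (r * r') = lin_ext sR (\<lambda>(h1, h2). act h1 r * act h2 r') (rep (\<Delta> h))"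

definition inner_faithful where
  "inner_faithful sH \<Delta> \<epsilon> S (act :: 'h::ring_1 \<Rightarrow> 'r::ring_1 \<Rightarrow> 'r) \<longleftrightarrow>
     (\<forall>I. hopf_ideal sH \<Delta> \<epsilon> S I \<and> (\<forall>h\<in>I. \<forall>r. act h r = 0) \<longrightarrow> I = {0})"

text \<open>The multiplication \<open>(r # h) (r' # h') = \<Sum> r (h\<^sub>1 \<cdot> r') # h\<^sub>2 h'\<close> of \<open>R # H\<close>, whose underlying
  vector space is \<open>tensor sR sH\<close>.\<close>

definition smash_mult ::
  "('k::field \<Rightarrow> 'h::ring_1 \<Rightarrow> 'h) \<Rightarrow> ('h \<Rightarrow> ('h \<times> 'h \<Rightarrow>\<^sub>0 'k) set) \<Rightarrow> ('k \<Rightarrow> 'r::ring_1 \<Rightarrow> 'r)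
    \<Rightarrow> ('h \<Rightarrow> 'r \<Rightarrow> 'r) \<Rightarrow> ('r \<times> 'h \<Rightarrow>\<^sub>0 'k) set \<Rightarrow> ('r \<times> 'h \<Rightarrow>\<^sub>0 'k) set \<Rightarrow> ('r \<times> 'h \<Rightarrow>\<^sub>0 'k) set" where
  "smash_mult sH \<Delta> sR act P Q = tcls sR sH
     (lin_ext fscale (\<lambda>(r, h). lin_ext fscale (\<lambda>(r', h').
        lin_ext fscale (\<lambda>(h1, h2). basis_vec (r * act h1 r', h2 * h')) (rep (\<Delta> h))) (rep Q)) (rep P))"

definition center_of :: "'t set \<Rightarrow> ('t \<Rightarrow> 't \<Rightarrow> 't) \<Rightarrow> 't set" where
  "center_of A m = {z \<in> A. \<forall>w\<in>A. m z w = m w z}"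

definition invariants :: "('h \<Rightarrow> 'k) \<Rightarrow> ('k \<Rightarrow> 'r \<Rightarrow> 'r) \<Rightarrow> ('h \<Rightarrow> 'r \<Rightarrow> 'r) \<Rightarrow> 'r set" where
  "invariants \<epsilon> sR act = {r. \<forall>h. act h r = sR (\<epsilon> h) r}"

definition X_inner :: "'r::ring_1 set \<Rightarrow> ('r \<Rightarrow> 'r) \<Rightarrow> bool" where
  "X_inner D \<sigma> \<longleftrightarrow> (\<exists>a\<in>D. a \<noteq> 0 \<and> (\<forall>r\<in>D. r * a = a * \<sigma> r))"

end

theory Submission
  imports Defs
begin

text \<open>Write a central element as \<open>\<Sum> r\<^sub>i\<^sub>j g\<^sup>i x\<^sup>j\<close> with \<open>i, j < n\<close>. Commuting with \<open>g\<close> and \<open>x\<close>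
  gives \<open>g(r\<^sub>i\<^sub>j) = \<lambda>\<^sup>j r\<^sub>i\<^sub>j\<close>, \<open>x(r\<^sub>i\<^sub>0) = 0\<close> and
  \<open>x(r\<^sub>i\<^sub>j) = (1 - \<lambda>\<^sup>i\<^sup>+\<^sup>j\<^sup>-\<^sup>1) r\<^sub>i\<^sub>,\<^sub>j\<^sub>-\<^sub>1\<close>. Commuting with \<open>d \<in> R\<^sup>\<langle>\<^sup>x\<^sup>\<rangle>\<close> gives
  \<open>d r\<^sub>i\<^sub>j = r\<^sub>i\<^sub>j g\<^sup>i\<^sup>+\<^sup>j(d)\<close>, and applying \<open>x\<close> repeatedly to this identity shows that the last
  nonzero element \<open>x\<^sup>m(r\<^sub>i\<^sub>j)\<close> makes \<open>g\<^sup>i\<^sup>+\<^sup>j\<^sup>-\<^sup>m\<close> \<open>X\<close>-inner on \<open>R\<^sup>\<langle>\<^sup>x\<^sup>\<rangle>\<close>. Hence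
  \<open>m\<close> is the residue of \<open>i + j\<close> modulo \<open>n\<close>, which contradicts the recursion unless \<open>i = j = 0\<close>
  or \<open>i + j = n\<close>. In the latter case, the coefficient of \<open>g\<^sup>i x\<^sup>j\<^sup>-\<^sup>1\<close> in the commutator with
  an arbitrary \<open>r \<in> R\<close> is, up to a nonzero scalar, \<open>r\<^sub>i\<^sub>j g\<^sup>n\<^sup>-\<^sup>1(x(r))\<close>. So if
  \<open>r\<^sub>i\<^sub>j \<noteq> 0\<close> then \<open>x\<close>, and with it the nonzero Hopf ideal \<open>H x\<close>, annihilates \<open>R\<close>.\<close>

section \<open>Tensor classes and linear extensions\<close>

lemma tensor_null_subspace: "fspace.subspace (tensor_null sA sB)"
  unfolding tensor_null_def by (rule fspace.subspace_span)

lemma tensor_null_relators: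
  "basis_vec (a + a', b) - basis_vec (a, b) - basis_vec (a', b) \<in> tensor_null sA sB"
  "basis_vec (a, b + b') - basis_vec (a, b) - basis_vec (a, b') \<in> tensor_null sA sB"
  "basis_vec (sA c a, b) - fscale c (basis_vec (a, b)) \<in> tensor_null sA sB"
  "basis_vec (a, sB c b) - fscale c (basis_vec (a, b)) \<in> tensor_null sA sB"
  unfolding tensor_null_def by (rule fspace.span_base; blast)+

lemma tcls_eq_iff: "tcls sA sB p = tcls sA sB q \<longleftrightarrow> p - q \<in> tensor_null sA sB"
  unfolding tcls_def
  using eq_equiv_class_iff[OF equiv_tensor_rel, of p q sA sB] by (simp add: tensor_rel_def)

lemma tcls_in_tensor: "tcls sA sB p \<in> tensor sA sB"
  by (auto simp: tensor_def tcls_def quotient_def)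

lemma rep_tcls: "(rep (tcls sA sB p), p) \<in> tensor_rel sA sB"
proof -
  have "p \<in> tcls sA sB p"
    using equiv_class_self[OF equiv_tensor_rel] by (simp add: tcls_def)
  then have "rep (tcls sA sB p) \<in> tcls sA sB p"
    unfolding rep_def by (rule someI)
  then have "(p, rep (tcls sA sB p)) \<in> tensor_rel sA sB"
    by (simp add: tcls_def)
  then show ?thesis
    using equiv_tensor_rel by (metis equiv_def symE)
qed

lemma rep_tcls_null: "rep (tcls sA sB p) - p \<in> tensor_null sA sB"
  using rep_tcls[of sA sB p] by (simp add: tensor_rel_def)

lemma tadd_tcls: "tadd sA sB (tcls sA sB p) (tcls sA sB q) = tcls sA sB (p + q)"
  using fspace.subspace_add[OF tensor_null_subspace rep_tcls_null rep_tcls_null, of sA sB p q]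
  by (simp add: tadd_def tcls_eq_iff algebra_simps)

lemma tcls_rep:
  assumes "T \<in> tensor sA sB"
  shows "tcls sA sB (rep T) = T"
proof -
  obtain p where "T = tcls sA sB p"
    using assms by (auto simp: tensor_def tcls_def quotient_def)
  then show ?thesis
    using rep_tcls[of sA sB p] by (simp add: tcls_eq_iff tensor_rel_def)
qed

text \<open>A bilinear map does not see which representative \<open>rep\<close> chooses, so a
  Sweedler sum or a coefficient can be computed from any expression of the tensor.\<close>

lemma lin_ext_rep_tcls:
  assumes "vector_space sC" "bilinear_map sA sB sC f"
  shows "lin_ext sC (\<lambda>(a, b). f a b) (rep (tcls sA sB p)) = lin_ext sC (\<lambda>(a, b). f a b) p"
  by (rule lin_ext_tensor_rel[OF assms rep_tcls])

lemma lin_ext_add: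
  assumes "vector_space s"
  shows "lin_ext s f (p + q) = lin_ext s f p + lin_ext s f q"
  using module_hom.add[OF module_hom_lin_ext[OF assms]] .

lemma lin_ext_diff:
  assumes "vector_space s"
  shows "lin_ext s f (p - q) = lin_ext s f p - lin_ext s f q"
  using module_hom.diff[OF module_hom_lin_ext[OF assms]] .

lemma lin_ext_fscale:
  assumes "vector_space s"
  shows "lin_ext s f (fscale c p) = s c (lin_ext s f p)"
  using module_hom.scale[OF module_hom_lin_ext[OF assms]] .

lemma lin_ext_add_fun:
  assumes "vector_space s"
  shows "lin_ext s (\<lambda>i. f i + f' i) p = lin_ext s f p + lin_ext s f' p"
proof -
  interpret vector_space s by fact
  show ?thesis by (simp add: lin_ext_def scale_right_distrib sum.distrib)
qed

lemma lin_ext_diff_fun: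
  assumes "vector_space s"
  shows "lin_ext s (\<lambda>i. f i - f' i) p = lin_ext s f p - lin_ext s f' p"
proof -
  interpret vector_space s by fact
  show ?thesis by (simp add: lin_ext_def scale_right_diff_distrib sum_subtractf)
qed

lemma lin_ext_scale_fun:
  assumes "vector_space s"
  shows "lin_ext s (\<lambda>i. s c (f i)) p = s c (lin_ext s f p)"
proof -
  interpret vector_space s by fact
  show ?thesis by (simp add: lin_ext_def scale_sum_right mult.commute)
qed

lemma lin_ext_sum_fun:
  assumes "vector_space s"
  shows "lin_ext s (\<lambda>i. \<Sum>b\<in>B. f b i) p = (\<Sum>b\<in>B. lin_ext s (f b) p)"
proof -
  interpret vector_space s by fact
  have "lin_ext s (\<lambda>i. 0) p = 0" by (simp add: lin_ext_def)
  then show ?thesis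
    by (induction B rule: infinite_finite_induct) (simp_all add: lin_ext_add_fun assms)
qed

lemma lin_ext_comp:
  fixes f :: "'i \<Rightarrow> 'c::ab_group_add" and L :: "'c \<Rightarrow> 'd::ab_group_add"
  assumes "\<And>a b. L (a + b) = L a + L b" "\<And>c a. L (s c a) = s' c (L a)"
  shows "L (lin_ext s f p) = lin_ext s' (\<lambda>i. L (f i)) p"
proof -
  have "L 0 = 0" using assms(1)[of 0 0] by simp
  then have "L (sum h A) = (\<Sum>i\<in>A. L (h i))" for h :: "'i \<Rightarrow> 'c" and A
    by (induction A rule: infinite_finite_induct) (simp_all add: assms(1))
  then show ?thesis by (simp add: lin_ext_def assms(2))
qed

lemma lin_ext_lin_ext:
  assumes "vector_space s"
  shows "lin_ext s f (lin_ext fscale k p) = lin_ext s (\<lambda>i. lin_ext s f (k i)) p"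
  by (rule lin_ext_comp) (simp_all add: assms lin_ext_add lin_ext_fscale)

lemma lin_ext_in_subspace:
  fixes f :: "'i \<Rightarrow> 'c::ab_group_add"
  assumes "\<And>a b. a \<in> U \<Longrightarrow> b \<in> U \<Longrightarrow> a + b \<in> U" "\<And>c a. a \<in> U \<Longrightarrow> s c a \<in> U" "0 \<in> U"
    "\<And>i. f i \<in> U"
  shows "lin_ext s f p \<in> U"
proof -
  have "sum h A \<in> U" if "\<And>i. h i \<in> U" for h :: "'i \<Rightarrow> 'c" and A
    using that by (induction A rule: infinite_finite_induct) (simp_all add: assms)
  then show ?thesis by (simp add: lin_ext_def assms)
qed

lemma lin_ext_rep_tadd:
  assumes "vector_space sC" "bilinear_map sA sB sC f"
  shows "lin_ext sC (\<lambda>(a, b). f a b) (rep (tadd sA sB P Q)) =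
    lin_ext sC (\<lambda>(a, b). f a b) (rep P) + lin_ext sC (\<lambda>(a, b). f a b) (rep Q)"
  by (simp add: tadd_def lin_ext_rep_tcls[OF assms] lin_ext_add assms(1))

lemma lin_ext_rep_tscale:
  assumes "vector_space sC" "bilinear_map sA sB sC f"
  shows "lin_ext sC (\<lambda>(a, b). f a b) (rep (tscale sA sB c P)) =
    sC c (lin_ext sC (\<lambda>(a, b). f a b) (rep P))"
  by (simp add: tscale_def lin_ext_rep_tcls[OF assms] lin_ext_fscale assms(1))

lemma lin_ext_rep_tens:
  assumes "vector_space sC" "bilinear_map sA sB sC f"
  shows "lin_ext sC (\<lambda>(a, b). f a b) (rep (tens sA sB a b)) = f a b"
  by (simp add: lin_ext_rep_tcls[OF assms] assms(1))

lemma lin_ext_rep_tmult: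
  assumes "vector_space sC" "bilinear_map s s sC f"
  shows "lin_ext sC (\<lambda>(a, b). f a b) (rep (tmult s P Q)) =
    lin_ext sC (\<lambda>(a, b). lin_ext sC (\<lambda>(a', b'). f (a * a') (b * b')) (rep Q)) (rep P)"
  unfolding tmult_def lin_ext_rep_tcls[OF assms] lin_ext_lin_ext[OF assms(1)]
  by (simp add: case_prod_unfold lin_ext_lin_ext assms(1))

context k_algebra
begin

lemma bilinear_map_mult:
  "bilinear_map scale scale sC f \<Longrightarrow> bilinear_map scale scale sC (\<lambda>a b. f (u * a) (v * b))"
  by (auto simp: bilinear_map_def algebra_simps simp flip: scale_mult_right)

lemma bilinear_map_mult_right:
  "bilinear_map scale scale sC f \<Longrightarrow> bilinear_map scale scale sC (\<lambda>a b. f (a * u) (b * v))"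
  by (auto simp: bilinear_map_def algebra_simps simp flip: scale_mult_left)

end

lemma bilinear_map_add:
  assumes "vector_space sC" "bilinear_map sA sB sC f" "bilinear_map sA sB sC f'"
  shows "bilinear_map sA sB sC (\<lambda>a b. f a b + f' a b)"
proof -
  interpret vector_space sC by fact
  show ?thesis using assms(2,3) by (auto simp: bilinear_map_def algebra_simps)
qed

lemma
  assumes "two_sided_ideal I"
  shows two_sided_ideal_zero: "0 \<in> I"
    and two_sided_ideal_add: "a \<in> I \<Longrightarrow> b \<in> I \<Longrightarrow> a + b \<in> I"
    and two_sided_ideal_mult_left: "b \<in> I \<Longrightarrow> a * b \<in> I"
    and two_sided_ideal_mult_right: "b \<in> I \<Longrightarrow> b * a \<in> I"
  using assms by (simp_all add: two_sided_ideal_def)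

lemma two_sided_ideal_sum:
  assumes "two_sided_ideal I" "\<And>i. i \<in> A \<Longrightarrow> f i \<in> I"
  shows "sum f A \<in> I"
  using assms(2)
  by (induction A rule: infinite_finite_induct)
    (simp_all add: assms(1) two_sided_ideal_zero two_sided_ideal_add)

text \<open>\<open>two_sided_ideal\<close> does not mention scalars, but scaling by \<open>c\<close>
  is multiplication by \<open>scale c 1\<close>.\<close>

lemma (in k_algebra) two_sided_ideal_scale:
  assumes "two_sided_ideal I" "a \<in> I"
  shows "scale c a \<in> I"
  using two_sided_ideal_mult_left[OF assms, of "scale c 1"] by (simp flip: scale_mult_left)

section \<open>Sweedler sums\<close>

context hopf_algebra
begin

lemma vector_space: "vector_space sH" ..

definition sweedler :: "('k \<Rightarrow> 'c \<Rightarrow> 'c) \<Rightarrow> ('h \<Rightarrow> 'h \<Rightarrow> 'c) \<Rightarrow> 'h \<Rightarrow> 'c::ab_group_add" where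
  "sweedler sC f h = lin_ext sC (\<lambda>(a, b). f a b) (rep (\<Delta> h))"

lemma
  assumes "vector_space sC" "bilinear_map sH sH sC f"
  shows sweedler_add: "sweedler sC f (h + h') = sweedler sC f h + sweedler sC f h'"
    and sweedler_scale: "sweedler sC f (sH c h) = sC c (sweedler sC f h)"
    and sweedler_one: "sweedler sC f 1 = f 1 1"
    and sweedler_mult: "sweedler sC f (h * h') =
      sweedler sC (\<lambda>a b. sweedler sC (\<lambda>a' b'. f (a * a') (b * b')) h') h"
  by (simp_all add: sweedler_def comult_add comult_scale comult_one comult_mult
      lin_ext_rep_tadd[OF assms] lin_ext_rep_tscale[OF assms] lin_ext_rep_tens[OF assms]
      lin_ext_rep_tmult[OF assms])

lemma sweedler_add_fun:
  "vector_space sC \<Longrightarrow>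
    sweedler sC (\<lambda>a b. f a b + f' a b) h = sweedler sC f h + sweedler sC f' h"
  using lin_ext_add_fun[of sC "\<lambda>(a, b). f a b"  "\<lambda>(a, b). f' a b"]
  by (simp add: sweedler_def case_prod_unfold)

lemma sweedler_comp:
  assumes "\<And>a b. L (a + b) = L a + L b" "\<And>c a. L (s c a) = s' c (L a)"
  shows "L (sweedler s f h) = sweedler s' (\<lambda>a b. L (f a b)) h"
  using lin_ext_comp[of L s s', OF assms, of "\<lambda>(a, b). f a b"]
  by (simp add: sweedler_def case_prod_unfold)

text \<open>The left counit law transported along \<open>L\<close>. It evaluates Sweedler sums in
  which \<epsilon> absorbs the first tensor factor.\<close>

lemma sweedler_counit_left:
  assumes "\<And>a b. L (a + b) = L a + L b" "\<And>c a. L (sH c a) = s' c (L a)"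
  shows "sweedler s' (\<lambda>a b. s' (\<epsilon> a) (L b)) h = L h"
proof -
  have "sweedler sH (\<lambda>a b. sH (\<epsilon> a) b) h = h"
    using counit_left by (simp add: sweedler_def)
  then show ?thesis
    using sweedler_comp[of L sH s' "\<lambda>a b. sH (\<epsilon> a) b" h, OF assms] by (simp add: assms(2))
qed

end

section \<open>Coordinates on the Taft algebra\<close>

text \<open>Pairs of an \<open>x\<close> and a \<open>g\<close> somewhere to its right: the exponent
  of \<open>lam\<close> when all \<open>g\<close> are moved to the front.\<close>

fun inversions :: "letter list \<Rightarrow> nat" where
  "inversions [] = 0"
| "inversions (Letter_g # w) = inversions w"
| "inversions (Letter_x # w) = count_list w Letter_g + inversions w"

lemma inversions_append:
  "inversions (u @ v) = inversions u + inversions v + count_list u Letter_x * count_list v Letter_g"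
  by (induction u rule: inversions.induct) (simp_all add: algebra_simps)

lemma inversions_replicate: "inversions (replicate m a) = 0"
  by (cases a; induction m) (simp_all add: count_list_0_iff)

lemma count_list_replicate: "count_list (replicate m a) b = (if a = b then m else 0)"
  by (induction m) auto

lemma word_eval_simps [simp]:
  "word_eval g x [] = 1"
  "word_eval g x (Letter_g # w) = g * word_eval g x w"
  "word_eval g x (Letter_x # w) = x * word_eval g x w"
  "word_eval g x (u @ v) = word_eval g x u * word_eval g x v"
  "word_eval g x (replicate m Letter_g) = g ^ m"
  "word_eval g x (replicate m Letter_x) = x ^ m"
  by (simp_all add: word_eval_def prod_list_replicate)

locale taft_root = taft_algebra n lam sH \<Delta> \<epsilon> S g x
  for n :: nat and lam :: "'k::field"
    and sH :: "'k \<Rightarrow> 'h::ring_1 \<Rightarrow> 'h" and \<Delta> \<epsilon> S and g x +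
  assumes n_gt_1: "n > 1" and root: "primitive_root n lam"
begin

lemma lam_pow_n: "lam ^ n = 1"
  using root by (simp add: primitive_root_def)

lemma lam_pow_neq_1: "0 < m \<Longrightarrow> m < n \<Longrightarrow> lam ^ m \<noteq> 1"
  using root by (simp add: primitive_root_def)

section \<open>Relations and commutation rules in the Taft algebra\<close>

lemma taft_relation:
  assumes "p \<in> taft_ideal n lam"
  shows "lin_ext sH (word_eval g x) p = 0"
  using assms presented by blast

lemma g_pow_n: "g ^ n = 1"
proof -
  have "basis_vec ([] @ replicate n Letter_g @ []) - basis_vec ([] @ []) \<in> taft_ideal n lam"
    unfolding taft_ideal_def by (rule fspace.span_base) blast
  from taft_relation[OF this] show ?thesis
    by (simp add: lin_ext_diff vector_space)
qed

lemma x_pow_n: "x ^ n = 0"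
proof -
  have "basis_vec ([] @ replicate n Letter_x @ []) \<in> taft_ideal n lam"
    unfolding taft_ideal_def by (rule fspace.span_base) blast
  from taft_relation[OF this] show ?thesis
    by (simp add: vector_space)
qed

lemma x_g: "x * g = sH lam (g * x)"
proof -
  have "basis_vec ([] @ [Letter_x, Letter_g] @ []) - fscale lam (basis_vec ([] @ [Letter_g, Letter_x] @ []))
      \<in> taft_ideal n lam"
    unfolding taft_ideal_def by (rule fspace.span_base) blast
  from taft_relation[OF this] show ?thesis
    by (simp add: vector_space lin_ext_diff lin_ext_fscale)
qed

lemma g_pow_mod: "g ^ (m mod n) = g ^ m"
proof -
  have "g ^ m = g ^ (n * (m div n) + m mod n)" by simp
  also have "\<dots> = g ^ (m mod n)" by (simp only: power_add power_mult g_pow_n) simp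
  finally show ?thesis ..
qed

lemma x_pow_eq_0: "n \<le> m \<Longrightarrow> x ^ m = 0"
  by (metis x_pow_n le_add_diff_inverse mult_zero_left power_add)

lemma x_g_pow: "x * g ^ m = sH (lam ^ m) (g ^ m * x)"
proof (induction m)
  case (Suc m)
  have "x * g ^ Suc m = sH lam (g * x) * g ^ m" by (simp add: mult.assoc[symmetric] x_g)
  also have "\<dots> = sH lam (g * (x * g ^ m))" by (simp add: scale_mult_left mult.assoc)
  also have "\<dots> = sH (lam ^ Suc m) (g ^ Suc m * x)"
    by (simp add: Suc scale_mult_right[symmetric] mult.assoc)
  finally show ?case .
qed simp

lemma x_pow_g: "x ^ m * g = sH (lam ^ m) (g * x ^ m)"
proof (induction m)
  case (Suc m)
  have "x ^ Suc m * g = x * (x ^ m * g)" by (simp add: mult.assoc)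
  also have "\<dots> = sH (lam ^ m) ((x * g) * x ^ m)" by (simp add: Suc scale_mult_right[symmetric] mult.assoc)
  also have "\<dots> = sH (lam ^ Suc m) (g * x ^ Suc m)"
    by (simp add: x_g scale_mult_left[symmetric] mult.assoc mult.commute)
  finally show ?case .
qed simp

text \<open>Sorting costs one \<open>lam\<close> for each \<open>g\<close> that an \<open>x\<close>
  has to pass, which is the total counted by \<open>inversions\<close>.\<close>

lemma word_eval_normal_form:
  "word_eval g x w =
    sH (lam ^ inversions w) (g ^ count_list w Letter_g * x ^ count_list w Letter_x)"
proof (induction w rule: inversions.induct)
  case (3 w)
  have "word_eval g x (Letter_x # w) =
      sH (lam ^ inversions w) ((x * g ^ count_list w Letter_g) * x ^ count_list w Letter_x)"
    by (simp add: 3 scale_mult_right[symmetric] mult.assoc)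
  then show ?case
    by (simp add: x_g_pow scale_mult_left[symmetric] mult.assoc power_add mult.commute)
qed (simp_all add: scale_mult_right[symmetric] mult.assoc)

lemma taft_elem:
  obtains p where "h = lin_ext sH (word_eval g x) p"
  using generated by auto

lemma taft_induct [case_names word add scale]:
  assumes word: "\<And>w. P (word_eval g x w)" and add: "\<And>a b. P a \<Longrightarrow> P b \<Longrightarrow> P (a + b)"
    and scale: "\<And>c a. P a \<Longrightarrow> P (sH c a)"
  shows "P h"
proof -
  obtain p where "h = lin_ext sH (word_eval g x) p" using generated by auto
  \<comment> \<open>Zero is \<open>0\<close> times the empty word, so no separate case for it is
    needed.\<close>
  moreover have "P 0" using scale[OF word[of "[]"], of 0] by simp
  ultimately show ?thesis
    using lin_ext_in_subspace[of "Collect P" sH "word_eval g x" p] assms by simp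
qed

text \<open>Straightening a word with \<open>x g = \<lambda> g x\<close> picks up one factor \<open>\<lambda>\<close> per pair of letters
  \<open>x\<close>, \<open>g\<close> in the wrong order. The resulting linear functionals on the free algebra kill the Taft
  relators, which gives the linear independence of the elements \<open>g\<^sup>i x\<^sup>j\<close>.\<close>

definition word_coord :: "nat \<Rightarrow> nat \<Rightarrow> letter list \<Rightarrow> 'k" where
  "word_coord i j w =
    (if count_list w Letter_g mod n = i \<and> count_list w Letter_x = j then lam ^ inversions w else 0)"

text \<open>The functional is read off from an arbitrary preimage in the free algebra. For
  \<open>j < n\<close> it kills the ideal of relations and is therefore well defined; this is the
  origin of the condition \<open>j < n\<close> below.\<close>

definition coord :: "nat \<Rightarrow> nat \<Rightarrow> 'h \<Rightarrow> 'k" where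
  "coord i j h = lin_ext (*) (word_coord i j) (SOME p. lin_ext sH (word_eval g x) p = h)"

lemma vector_space_mult: "vector_space ((*) :: 'k \<Rightarrow> 'k \<Rightarrow> 'k)"
  by standard (simp_all add: algebra_simps)

text \<open>Inserting \<open>g ^ n\<close> changes the number of \<open>g\<close> and the number of
  inversions by multiples of \<open>n\<close>, which is invisible modulo \<open>n\<close> and
  because \<open>lam ^ n = 1\<close>. A word containing \<open>x ^ n\<close> has more than
  \<open>j\<close> letters \<open>x\<close>. Swapping \<open>x g\<close> to \<open>g x\<close>
  removes exactly one inversion.\<close>

lemma word_coord_taft_ideal:
  assumes "j < n" "p \<in> taft_ideal n lam"
  shows "lin_ext (*) (word_coord i j) p = 0"
proof -
  interpret L: module_hom fscale "(*)" "lin_ext (*) (word_coord i j)"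
    by (rule module_hom_lin_ext) (rule vector_space_mult)
  have c1: "word_coord i j (u @ replicate n Letter_g @ v) = word_coord i j (u @ v)" for u v
  proof -
    have "inversions (u @ replicate n Letter_g @ v) =
        inversions (u @ v) + n * count_list u Letter_x"
      by (simp add: inversions_append inversions_replicate count_list_replicate algebra_simps)
    then have "lam ^ inversions (u @ replicate n Letter_g @ v) = lam ^ inversions (u @ v)"
      by (simp add: power_add power_mult lam_pow_n)
    moreover have "count_list (u @ replicate n Letter_g @ v) Letter_g mod n =
        count_list (u @ v) Letter_g mod n"
      by (simp add: count_list_replicate add.left_commute[of _ n])
    ultimately show ?thesis
      by (simp add: word_coord_def count_list_replicate)
  qed
  have c2: "word_coord i j (u @ replicate n Letter_x @ v) = 0" for u v
    using assms(1) by (auto simp: word_coord_def count_list_replicate)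
  have c3: "word_coord i j (u @ Letter_x # Letter_g # v) = lam * word_coord i j (u @ Letter_g # Letter_x # v)" for u v
    by (auto simp: word_coord_def inversions_append)
  show ?thesis
    by (rule L.eq_0_on_span[OF _ assms(2)[unfolded taft_ideal_def]])
      (auto simp: L.diff L.scale vector_space_mult c1 c2 c3)
qed

lemma coord_lin_ext:
  assumes "j < n"
  shows "coord i j (lin_ext sH (word_eval g x) p) = lin_ext (*) (word_coord i j) p"
proof -
  define q where "q = (SOME q. lin_ext sH (word_eval g x) q = lin_ext sH (word_eval g x) p)"
  have "lin_ext sH (word_eval g x) q = lin_ext sH (word_eval g x) p"
    unfolding q_def by (rule someI[of _ p]) (rule refl)
  then have "q - p \<in> taft_ideal n lam"
    by (simp add: presented[symmetric] lin_ext_diff vector_space)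
  from word_coord_taft_ideal[OF assms this, of i] show ?thesis
    by (simp add: coord_def q_def lin_ext_diff vector_space_mult)
qed

lemma coord_word: "j < n \<Longrightarrow> coord i j (word_eval g x w) = word_coord i j w"
  using coord_lin_ext[of j i "basis_vec w"] by (simp add: vector_space vector_space_mult)

lemma coord_add:
  assumes "j < n"
  shows "coord i j (a + b) = coord i j a + coord i j b"
proof -
  obtain p where p: "a = lin_ext sH (word_eval g x) p" by (rule taft_elem)
  obtain q where q: "b = lin_ext sH (word_eval g x) q" by (rule taft_elem)
  have "a + b = lin_ext sH (word_eval g x) (p + q)"
    by (simp add: p q lin_ext_add vector_space)
  then show ?thesis
    by (simp add: p q coord_lin_ext assms lin_ext_add vector_space_mult)
qed

lemma coord_scale:
  assumes "j < n"
  shows "coord i j (sH c a) = c * coord i j a"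
proof -
  obtain p where p: "a = lin_ext sH (word_eval g x) p" by (rule taft_elem)
  have "sH c a = lin_ext sH (word_eval g x) (fscale c p)"
    by (simp add: p lin_ext_fscale vector_space)
  then show ?thesis
    by (simp add: p coord_lin_ext assms lin_ext_fscale vector_space_mult)
qed

lemma coord_basis:
  assumes "i < n" "j < n" "b < n"
  shows "coord a b (g ^ i * x ^ j) = (if a = i \<and> b = j then 1 else 0)"
  using coord_word[OF assms(3), of a "replicate i Letter_g @ replicate j Letter_x"] assms
  by (auto simp: word_coord_def count_list_replicate inversions_append inversions_replicate)

lemma coord_one: "b < n \<Longrightarrow> coord a b 1 = (if a = 0 \<and> b = 0 then 1 else 0)"
  using coord_basis[of 0 0] n_gt_1 by simp

lemma taft_basis: "h = (\<Sum>i<n. \<Sum>j<n. sH (coord i j h) (g ^ i * x ^ j))"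
proof (induction h rule: taft_induct)
  case (word w)
  let ?i = "count_list w Letter_g mod n" and ?j = "count_list w Letter_x"
  have "(\<Sum>i<n. \<Sum>j<n. sH (coord i j (word_eval g x w)) (g ^ i * x ^ j)) =
      (\<Sum>i<n. \<Sum>j<n. sH (word_coord i j w) (g ^ i * x ^ j))"
    by (simp add: coord_word)
  also have "\<dots> = (\<Sum>i<n. \<Sum>j<n. if j = ?j then
      (if i = ?i then sH (lam ^ inversions w) (g ^ i * x ^ j) else 0) else 0)"
    by (intro sum.cong refl) (simp add: word_coord_def)
  \<comment> \<open>For \<open>?j \<ge> n\<close> no coordinate is hit, in agreement with
    \<open>x ^ n = 0\<close> in the next step.\<close>
  also have "\<dots> = (if ?j < n then sH (lam ^ inversions w) (g ^ ?i * x ^ ?j) else 0)"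
    using n_gt_1 by (cases "?j < n") simp_all
  also have "\<dots> = word_eval g x w"
    by (simp add: word_eval_normal_form g_pow_mod x_pow_eq_0)
  finally show ?case ..
next
  case (add a b)
  then show ?case
    by (simp add: coord_add scale_left_distrib sum.distrib)
next
  case (scale c a)
  have "(\<Sum>i<n. \<Sum>j<n. sH (coord i j (sH c a)) (g ^ i * x ^ j)) =
      sH c (\<Sum>i<n. \<Sum>j<n. sH (coord i j a) (g ^ i * x ^ j))"
    by (simp add: coord_scale scale_sum_right)
  also have "\<dots> = sH c a" using scale by simp
  finally show ?case ..
qed

lemma Suc_mod_eq_iff: "i < n \<Longrightarrow> Suc m mod n = Suc i mod n \<longleftrightarrow> m mod n = i"
  by (auto simp: mod_Suc)

text \<open>Indexing by the position after the shift avoids a predecessor modulo \<open>n\<close>,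
  the exponent of \<open>g\<close> being cyclic.\<close>

lemma coord_g_mult:
  assumes "i < n" "j < n"
  shows "coord (Suc i mod n) j (g * h) = coord i j h"
proof (induction h rule: taft_induct)
  case (word w)
  show ?case
    using assms coord_word[OF assms(2), of "Suc i mod n" "Letter_g # w"]
    by (simp add: coord_word word_coord_def Suc_mod_eq_iff)
qed (simp_all add: assms coord_add coord_scale scale_mult_right[symmetric] distrib_left)

lemma coord_mult_g:
  assumes "i < n" "j < n"
  shows "coord (Suc i mod n) j (h * g) = lam ^ j * coord i j h"
proof (induction h rule: taft_induct)
  case (word w)
  show ?case
    using assms coord_word[OF assms(2), of "Suc i mod n" "w @ [Letter_g]"]
    by (simp add: coord_word word_coord_def Suc_mod_eq_iff inversions_append power_add)
qed (simp_all add: assms coord_add coord_scale scale_mult_left[symmetric] distrib_right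
   distrib_left)

lemma coord_x_mult:
  assumes "i < n" "j < n"
  shows "coord i j (x * h) = (if j = 0 then 0 else lam ^ i * coord i (j - 1) h)"
proof (induction h rule: taft_induct)
  case (word w)
  \<comment> \<open>Passing the letters \<open>g\<close> of \<open>w\<close> produces
    \<open>lam\<close> to their number, of which \<open>i\<close> is only the residue modulo
    \<open>n\<close>.\<close>
  have lam_mod: "lam ^ m = lam ^ (m mod n)" for m
  proof -
    have "lam ^ m = lam ^ (n * (m div n) + m mod n)" by simp
    then show ?thesis by (simp only: power_add power_mult lam_pow_n) simp
  qed
  show ?case
    using assms coord_word[OF assms(2), of i "Letter_x # w"]
      lam_mod[of "count_list w Letter_g"]
    by (auto simp: coord_word word_coord_def power_add)
next
  case (add a b)
  then show ?case using assms by (auto simp: coord_add distrib_left)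
next
  case (scale c a)
  then show ?case using assms by (auto simp: coord_scale scale_mult_right[symmetric])
qed

lemma coord_mult_x:
  assumes "j < n"
  shows "coord i j (h * x) = (if j = 0 then 0 else coord i (j - 1) h)"
proof (induction h rule: taft_induct)
  case (word w)
  show ?case
    using assms coord_word[OF assms, of i "w @ [Letter_x]"]
    by (auto simp: coord_word word_coord_def inversions_append)
next
  case (add a b)
  then show ?case using assms by (auto simp: coord_add distrib_right)
next
  case (scale c a)
  then show ?case using assms by (auto simp: coord_scale scale_mult_left[symmetric])
qed

lemma x_nonzero: "x \<noteq> 0"
proof
  assume "x = 0"
  then show False
    using coord_basis[of 0 1 1 0] coord_scale[of 1 0 0 x] n_gt_1 by simp
qed

section \<open>Coproducts involving \<open>g\<close> and \<open>x\<close>, and the Hopf ideal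
  \<open>H x\<close>\<close>

lemma sweedler_g:
  "vector_space sC \<Longrightarrow> bilinear_map sH sH sC f \<Longrightarrow> sweedler sC f g = f g g"
  by (simp add: sweedler_def comult_g lin_ext_rep_tens)

lemma sweedler_x:
  "vector_space sC \<Longrightarrow> bilinear_map sH sH sC f \<Longrightarrow> sweedler sC f x = f g x + f x 1"
  by (simp add: sweedler_def comult_x lin_ext_rep_tadd lin_ext_rep_tens)

lemma sweedler_mult_g:
  assumes "vector_space sC" "bilinear_map sH sH sC f"
  shows "sweedler sC f (h * g) = sweedler sC (\<lambda>a b. f (a * g) (b * g)) h"
  by (simp add: sweedler_mult[OF assms] sweedler_g[OF assms(1) bilinear_map_mult[OF assms(2)]])

lemma sweedler_mult_x:
  assumes "vector_space sC" "bilinear_map sH sH sC f"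
  shows "sweedler sC f (h * x) = sweedler sC (\<lambda>a b. f (a * g) (b * x) + f (a * x) b) h"
  by (simp add: sweedler_mult[OF assms] sweedler_x[OF assms(1) bilinear_map_mult[OF assms(2)]])

lemma sweedler_g_pow:
  assumes "vector_space sC" "bilinear_map sH sH sC f"
  shows "sweedler sC f (g ^ m) = f (g ^ m) (g ^ m)"
  using assms(2)
proof (induction m arbitrary: f)
  case (Suc m)
  show ?case
    using Suc.IH[OF bilinear_map_mult_right[OF Suc.prems, of g g]]
    by (simp only: power_Suc2 sweedler_mult_g[OF assms(1) Suc.prems])
qed (simp add: sweedler_one assms(1))

text \<open>\<open>x\<close> is normal: it commutes with every word up to a power of
  \<open>lam\<close>, so \<open>x H\<close> is contained in \<open>H x\<close>.\<close>

lemma two_sided_ideal_x: "two_sided_ideal (range (\<lambda>h. h * x))"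
proof -
  have "\<exists>h'. x * h = h' * x" for h
  proof -
    have "x * word_eval g x w = sH (lam ^ count_list w Letter_g) (word_eval g x w) * x" for w
    proof (induction w rule: inversions.induct)
      case (2 w)
      have "x * word_eval g x (Letter_g # w) = sH lam (g * (x * word_eval g x w))"
        by (simp add: x_g mult.assoc[symmetric] scale_mult_left)
      then show ?case
        by (simp add: 2 mult.assoc flip: scale_mult_left scale_mult_right)
    next
      case (3 w)
      have "x * word_eval g x (Letter_x # w) =
          x * (sH (lam ^ count_list w Letter_g) (word_eval g x w) * x)"
        by (simp add: 3)
      then show ?case
        by (simp add: mult.assoc flip: scale_mult_left scale_mult_right)
    qed simp
    then show ?thesis
    proof (induction h rule: taft_induct)
      case (add a b)
      then show ?case by (metis distrib_left distrib_right)
    next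
      case (scale c a)
      then show ?case by (metis scale_mult_left scale_mult_right)
    qed blast
  qed
  then have "b * x * a \<in> range (\<lambda>h. h * x)" for a b
    by (metis mult.assoc rangeI)
  moreover have "a * (b * x) \<in> range (\<lambda>h. h * x)" for a b
    by (metis mult.assoc rangeI)
  moreover have "a * x + b * x \<in> range (\<lambda>h. h * x)" for a b
    by (metis distrib_right rangeI)
  ultimately show ?thesis
    unfolding two_sided_ideal_def by (auto intro: range_eqI[of _ _ 0])
qed

text \<open>Each term of \<open>\<Delta> h\<close> times
  \<open>g \<otimes> x + x \<otimes> 1\<close> has a tensor factor ending in \<open>x\<close>. The
  condition concerns a single representative, hence the explicit \<open>?q\<close>.\<close>

lemma comult_mult_x:
  "\<exists>q \<in> fspace.span {basis_vec (a, b) | a b. a \<in> range (\<lambda>h. h * x) \<or> b \<in> range (\<lambda>h. h * x)}.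
    \<Delta> (h * x) = tcls sH sH q"
proof -
  let ?m = "\<lambda>a b. lin_ext fscale (\<lambda>(a', b'). basis_vec (a * a', b * b'))
     :: ('h \<times> 'h \<Rightarrow>\<^sub>0 'k) \<Rightarrow> ('h \<times> 'h \<Rightarrow>\<^sub>0 'k)"
  let ?S = "{basis_vec (a, b) :: 'h \<times> 'h \<Rightarrow>\<^sub>0 'k | a b. a \<in> range (\<lambda>h. h * x) \<or> b \<in> range (\<lambda>h. h * x)}"
  let ?N = "tensor_null sH sH"
  \<comment> \<open>\<open>?m a b\<close> is left multiplication by \<open>a \<otimes> b\<close> on
    representatives. It respects the bilinearity relators, so \<open>rep (\<Delta> x)\<close> may be
    replaced by the given expression of \<open>\<Delta> x\<close>.\<close>
  have m_null: "?m a b z \<in> ?N" if "z \<in> ?N" for a b z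
  proof -
    interpret m: module_hom fscale fscale "?m a b"
      by (rule module_hom_lin_ext) (rule fspace.vector_space_axioms)
    have "fspace.span (?m a b ` R) \<subseteq> ?N" if "?m a b ` R \<subseteq> ?N" for R
      using that by (rule fspace.span_minimal) (rule tensor_null_subspace)
    then have *: "z \<in> fspace.span R \<Longrightarrow> ?m a b ` R \<subseteq> ?N \<Longrightarrow> ?m a b z \<in> ?N" for R z
      using m.span_image by blast
    show ?thesis
    proof (rule *[OF that[unfolded tensor_null_def]])
      have e: "?m a b (basis_vec (a', b')) = basis_vec (a * a', b * b')" for a' b'
        by (simp add: fspace.vector_space_axioms)
      show "?m a b ` ({basis_vec (a + a', b) - basis_vec (a, b) - basis_vec (a', b) | a a' b. True} \<union>
        {basis_vec (a, b + b') - basis_vec (a, b) - basis_vec (a, b') | a b b'. True} \<union>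
        {basis_vec (sH c a, b) - fscale c (basis_vec (a, b)) | c a b. True} \<union>
        {basis_vec (a, sH c b) - fscale c (basis_vec (a, b)) | c a b. True}) \<subseteq> ?N"
        by (auto simp: m.diff m.scale e distrib_left tensor_null_relators
            simp flip: scale_mult_right)
    qed
  qed
  let ?q = "lin_ext fscale (\<lambda>(a, b). basis_vec (a * g, b * x) + basis_vec (a * x, b)) (rep (\<Delta> h))"
  have dx: "rep (\<Delta> x) - (basis_vec (g, x) + basis_vec (x, 1)) \<in> ?N"
    using rep_tcls_null by (simp add: comult_x tadd_tcls)
  have "?m a b (rep (\<Delta> x)) - (basis_vec (a * g, b * x) + basis_vec (a * x, b)) \<in> ?N" for a b
    using m_null[OF dx, of a b]
    by (simp add: lin_ext_diff lin_ext_add fspace.vector_space_axioms)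
  then have "lin_ext fscale (\<lambda>i. (\<lambda>(a, b). ?m a b (rep (\<Delta> x))) i -
      (\<lambda>(a, b). basis_vec (a * g, b * x) + basis_vec (a * x, b)) i) (rep (\<Delta> h)) \<in> ?N"
    by (intro lin_ext_in_subspace)
      (auto intro: fspace.subspace_add[OF tensor_null_subspace]
        fspace.subspace_scale[OF tensor_null_subspace] fspace.subspace_0[OF tensor_null_subspace])
  then have "lin_ext fscale (\<lambda>(a, b). ?m a b (rep (\<Delta> x))) (rep (\<Delta> h)) - ?q \<in> ?N"
    by (simp only: lin_ext_diff_fun fspace.vector_space_axioms)
  then have "\<Delta> (h * x) = tcls sH sH ?q"
    by (simp add: comult_mult tmult_def tcls_eq_iff)
  moreover have "basis_vec (a * g, b * x) \<in> fspace.span ?S"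
      "basis_vec (a * x, b) \<in> fspace.span ?S" for a b
    by (rule fspace.span_base; blast)+
  then have "?q \<in> fspace.span ?S"
    by (intro lin_ext_in_subspace)
      (auto intro: fspace.span_add fspace.span_scale fspace.span_zero)
  ultimately show ?thesis by blast
qed

text \<open>Modulo a two-sided ideal containing the lower terms, only the summand
  \<open>g\<^sup>i x\<^sup>j \<otimes> g\<^sup>i\<close> of the coproduct of \<open>g\<^sup>i x\<^sup>j\<close> contributes.\<close>

lemma sweedler_leading_term:
  assumes bilinear: "bilinear_map sH sH sH f"
    and ideal: "two_sided_ideal I"
    and lower: "\<And>a b h. b < j \<Longrightarrow> f (g ^ a * x ^ b) h \<in> I"
  shows "sweedler sH f (g ^ i * x ^ j) - f (g ^ i * x ^ j) (g ^ i) \<in> I"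
  using bilinear lower
proof (induction j arbitrary: f)
  case 0
  then show ?case
    using ideal by (simp add: sweedler_g_pow vector_space two_sided_ideal_def)
next
  case (Suc j)
  \<comment> \<open>Splitting off the last \<open>x\<close> replaces \<open>f\<close> by
    \<open>?f\<close>. Both summands of \<open>?f\<close> raise the \<open>x\<close>-degree of the
    first argument by at most one, so the hypothesis on lower terms passes to \<open>?f\<close>;
    hence the induction over all \<open>f\<close>.\<close>
  let ?f = "\<lambda>a b. f (a * g) (b * x) + f (a * x) b"
  have f_scale: "f (sH c a) b = sH c (f a b)" for c a b
    using Suc.prems(1) by (simp add: bilinear_map_def)
  have comm: "f (g ^ a * x ^ b * g) h = sH (lam ^ b) (f (g ^ Suc a * x ^ b) h)" for a b h
  proof -
    have "g ^ a * x ^ b * g = sH (lam ^ b) (g ^ Suc a * x ^ b)"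
      by (simp add: mult.assoc x_pow_g power_Suc2 del: power_Suc flip: scale_mult_right)
    then show ?thesis by (simp only: f_scale)
  qed
  have bil: "bilinear_map sH sH sH ?f"
    using bilinear_map_add[OF vector_space bilinear_map_mult_right[OF Suc.prems(1), of g x]
        bilinear_map_mult_right[OF Suc.prems(1), of x 1]] by simp
  have "sweedler sH ?f (g ^ i * x ^ j) - ?f (g ^ i * x ^ j) (g ^ i) \<in> I"
  proof (rule Suc.IH[OF bil])
    fix a b h assume "b < j"
    then show "?f (g ^ a * x ^ b) h \<in> I"
      unfolding comm unfolding mult.assoc power_Suc2[symmetric]
      by (intro two_sided_ideal_add[OF ideal] two_sided_ideal_scale[OF ideal] Suc.prems(2)) simp_all
  qed
  moreover have "f (g ^ i * x ^ j * g) (g ^ i * x) \<in> I"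
    unfolding comm by (intro two_sided_ideal_scale[OF ideal] Suc.prems(2)) simp
  ultimately have "sweedler sH ?f (g ^ i * x ^ j) - ?f (g ^ i * x ^ j) (g ^ i) +
      f (g ^ i * x ^ j * g) (g ^ i * x) \<in> I"
    by (rule two_sided_ideal_add[OF ideal])
  then show ?case
    using sweedler_mult_x[OF vector_space Suc.prems(1), of "g ^ i * x ^ j"]
    by (simp add: mult.assoc power_Suc2 del: power_Suc)
qed

text \<open>The locale does not provide the antimultiplicativity of \<open>S\<close>; the identity
  \<open>\<Sum> S(h\<^sub>1) h\<^sub>2 = \<epsilon>(h)\<close> for \<open>h \<in> H x\<close> determines \<open>S (g\<^sup>i x\<^sup>j x)\<close> modulo \<open>H x\<close> inductively.\<close>

lemma antipode_mult_x: "S (h * x) \<in> range (\<lambda>h. h * x)"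
proof -
  let ?I = "range (\<lambda>h. h * x)"
  note ideal = two_sided_ideal_x
  note I_add = two_sided_ideal_add[OF ideal]
    and I_mult_left = two_sided_ideal_mult_left[OF ideal]
    and I_mult_right = two_sided_ideal_mult_right[OF ideal]
  have bil: "bilinear_map sH sH sH (\<lambda>a b. S a * b)"
    by (auto simp: bilinear_map_def antipode_add antipode_scale algebra_simps scale_mult_left
      simp flip: scale_mult_right)
  have bil_x: "bilinear_map sH sH sH (\<lambda>a b. S (a * x) * b)"
    using bilinear_map_mult_right[OF bil, of x 1] by simp
  \<comment> \<open>In the antipode law at \<open>h * x\<close> the right-hand side is
    \<open>0\<close> since \<open>\<epsilon> x = 0\<close>, and the other summand of the coproduct
    gives a product ending in \<open>x\<close>.\<close>
  have conv: "sweedler sH (\<lambda>a b. S (a * x) * b) h \<in> ?I" for h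
  proof -
    have "0 = sweedler sH (\<lambda>a b. S a * b) (h * x)"
      using antipode_left[of "h * x"] by (simp add: sweedler_def counit_mult counit_x)
    also have "\<dots> = sweedler sH (\<lambda>a b. S (a * g) * (b * x)) h + sweedler sH (\<lambda>a b. S (a * x) * b) h"
      by (simp add: sweedler_mult_x[OF vector_space bil] sweedler_add_fun vector_space)
    also have "sweedler sH (\<lambda>a b. S (a * g) * (b * x)) h = sweedler sH (\<lambda>a b. S (a * g) * b) h * x"
      using sweedler_comp[of "\<lambda>y. y * x" sH sH "\<lambda>a b. S (a * g) * b" h]
      by (simp add: distrib_right scale_mult_left mult.assoc)
    finally have "sweedler sH (\<lambda>a b. S (a * x) * b) h = - sweedler sH (\<lambda>a b. S (a * g) * b) h * x"
      by (simp add: eq_neg_iff_add_eq_0 add.commute)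
    then show ?thesis by blast
  qed
  have "S (g ^ i * x ^ j * x) \<in> ?I" for i j
  proof (induction j arbitrary: i rule: less_induct)
    case (less j)
    \<comment> \<open>Smaller powers of \<open>x\<close> are covered by the induction hypothesis, so
      modulo \<open>H x\<close> the sum in \<open>conv\<close> reduces to its leading term.\<close>
    have "sweedler sH (\<lambda>a b. S (a * x) * b) (g ^ i * x ^ j) - S (g ^ i * x ^ j * x) * g ^ i \<in> ?I"
      by (rule sweedler_leading_term[OF bil_x ideal]) (intro I_mult_right less)
    from I_add[OF conv[of "g ^ i * x ^ j"] I_mult_left[OF this, of "-1"]]
    have "S (g ^ i * x ^ j * x) * g ^ i \<in> ?I"
      by simp
    \<comment> \<open>\<open>g ^ (n * i - i)\<close> is the inverse of \<open>g ^ i\<close>.\<close>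
    from I_mult_right[OF this, of "g ^ (n * i - i)"]
    show ?case
      using n_gt_1 by (simp add: mult.assoc power_mult g_pow_n flip: power_add)
  qed
  note basis = this
  have "S (sum f A) = (\<Sum>a\<in>A. S (f a))" for f :: "nat \<Rightarrow> 'h" and A
    using antipode_add[of 0 0]
    by (induction A rule: infinite_finite_induct) (simp_all add: antipode_add)
  then have "S (h * x) = (\<Sum>i<n. \<Sum>j<n. sH (coord i j h) (S (g ^ i * x ^ j * x)))"
    by (subst taft_basis[of h])
      (simp add: sum_distrib_right antipode_scale flip: scale_mult_left)
  also have "\<dots> \<in> ?I"
    by (intro two_sided_ideal_sum[OF ideal] two_sided_ideal_scale[OF ideal] basis)
  finally show ?thesis .
qed

lemma hopf_ideal_x: "hopf_ideal sH \<Delta> \<epsilon> S (range (\<lambda>h. h * x))"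
  unfolding hopf_ideal_def
  using two_sided_ideal_x comult_mult_x antipode_mult_x
  by (auto simp: counit_mult counit_x image_iff)

end

section \<open>Coordinates on the smash product\<close>

locale taft_action = taft_root n lam sH \<Delta> \<epsilon> S g x + module_algebra sH \<Delta> \<epsilon> S sR act
  for n :: nat and lam :: "'k::field"
    and sH :: "'k \<Rightarrow> 'h::ring_1 \<Rightarrow> 'h" and \<Delta> \<epsilon> S and g x
    and sR :: "'k \<Rightarrow> 'r::ring_1_no_zero_divisors \<Rightarrow> 'r" and act
begin

lemma R_vector_space: "vector_space sR" ..

lemma act_add_left: "act (h + h') r = act h r + act h' r"
  and act_add: "act h (r + r') = act h r + act h r'"
  and act_scale_left: "act (sH c h) r = sR c (act h r)"
  and act_scale: "act h (sR c r) = sR c (act h r)"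
  using act_bilinear by (simp_all add: bilinear_map_def)

lemma act_zero [simp]: "act h 0 = 0"
  using act_add[of h 0 0] by simp

lemma act_sweedler: "act h (r * r') = sweedler sR (\<lambda>a b. act a r * act b r') h"
  by (simp add: act_prod sweedler_def)

lemma bilinear_act: "bilinear_map sH sH sR (\<lambda>a b. act a r * act b r')"
  by (auto simp: bilinear_map_def act_add_left act_scale_left distrib_left distrib_right
      simp flip: R.scale_mult_left R.scale_mult_right)

lemma act_x_mult: "act x (r * r') = act g r * act x r' + act x r * r'"
  by (simp add: act_sweedler sweedler_x[OF R_vector_space bilinear_act] act_one)

lemma act_x_g: "act x (act g r) = sR lam (act g (act x r))"
  using arg_cong[OF x_g, of "\<lambda>h. act h r"] by (simp add: act_mult act_scale_left)

lemma act_x_g_pow: "act x (act (g ^ m) r) = sR (lam ^ m) (act (g ^ m) (act x r))"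
  using arg_cong[OF x_g_pow, of "\<lambda>h. act h r" m] by (simp add: act_mult act_scale_left)

lemma act_g_pow_g: "act (g ^ m) (act g r) = act (g ^ Suc m) r"
  by (simp add: power_Suc2 act_mult del: power_Suc)

lemma act_g_pow_mod: "act (g ^ (m mod n)) r = act (g ^ m) r"
  by (simp add: g_pow_mod)

text \<open>In \<open>R # H\<close>, \<open>expand i j r h\<close> is the coefficient of \<open>g\<^sup>i x\<^sup>j\<close> in
  \<open>(1 # h) (r # 1)\<close>.\<close>

definition expand :: "nat \<Rightarrow> nat \<Rightarrow> 'r \<Rightarrow> 'h \<Rightarrow> 'r" where
  "expand i j r = sweedler sR (\<lambda>a b. sR (coord i j b) (act a r))"

lemma bilinear_expand:
  assumes "j < n"
  shows "bilinear_map sH sH sR (\<lambda>a b. sR (coord i j b) (act a r))"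
  using assms
  by (auto simp: bilinear_map_def act_add_left act_scale_left coord_add coord_scale
      R.scale_left_distrib R.scale_right_distrib R.scale_left_commute mult.commute)

lemma expand_zero: "expand i j 0 h = 0"
  by (simp add: expand_def sweedler_def lin_ext_def)

lemma
  assumes "j < n"
  shows expand_add: "expand i j r (h + h') = expand i j r h + expand i j r h'"
    and expand_scale: "expand i j r (sH c h) = sR c (expand i j r h)"
  unfolding expand_def
  by (rule sweedler_add[OF R_vector_space bilinear_expand[OF assms]]
      sweedler_scale[OF R_vector_space bilinear_expand[OF assms]])+

lemma expand_g_pow:
  assumes "i < n" "j < n" "m < n"
  shows "expand i j r (g ^ m) = (if i = m \<and> j = 0 then act (g ^ m) r else 0)"
  using coord_basis[of m 0 j i] assms n_gt_1
  by (simp add: expand_def sweedler_g_pow[OF R_vector_space bilinear_expand])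

text \<open>Encodes \<open>x r = g(r) x + x(r)\<close> in \<open>R # H\<close>: the last
  \<open>x\<close> either passes \<open>r\<close>, which becomes \<open>g(r)\<close>, or acts on it.
  The values at \<open>g^i x^j\<close> follow from this recursion.\<close>

lemma expand_mult_x:
  assumes "j < n"
  shows "expand i j r (h * x) =
    (if j = 0 then 0 else expand i (j - 1) (act g r) h) + expand i j (act x r) h"
proof -
  have "expand i j r (h * x) = sweedler sR (\<lambda>a b.
      sR (coord i j (b * x)) (act (a * g) r) + sR (coord i j b) (act (a * x) r)) h"
    unfolding expand_def by (rule sweedler_mult_x[OF R_vector_space bilinear_expand[OF assms]])
  also have "\<dots> = sweedler sR (\<lambda>a b. sR (coord i j (b * x)) (act a (act g r))) h +
      expand i j (act x r) h"
    by (simp add: sweedler_add_fun R_vector_space expand_def act_mult)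
  also have "sweedler sR (\<lambda>a b. sR (coord i j (b * x)) (act a (act g r))) h =
      (if j = 0 then 0 else expand i (j - 1) (act g r) h)"
    using assms by (simp add: coord_mult_x expand_def) (simp add: sweedler_def lin_ext_def)
  finally show ?thesis .
qed

text \<open>Passing \<open>r\<close> leaves the power of \<open>g\<close> unchanged and can only
  lower the power of \<open>x\<close>.\<close>

lemma expand_basis_upper:
  assumes "a < n" "b < n" "i < n" "a \<noteq> i \<or> j < b"
  shows "expand a b r (g ^ i * x ^ j) = 0"
  using assms
proof (induction j arbitrary: b r)
  case (Suc j)
  have "expand a b r (g ^ i * x ^ j * x) = 0"
    unfolding expand_mult_x[OF Suc.prems(2)] using Suc by (cases b) auto
  then show ?case by (simp add: mult.assoc power_Suc2 del: power_Suc)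
qed (auto simp: expand_g_pow)

text \<open>If \<open>x\<close> kills \<open>r\<close>, it also kills \<open>g(r)\<close>, so only
  the first summand of the recursion survives at every stage.\<close>

lemma expand_basis_x_kernel:
  assumes "a < n" "b < n" "i < n" "act x r = 0"
  shows "expand a b r (g ^ i * x ^ j) = (if a = i \<and> b = j then act (g ^ (i + j)) r else 0)"
  using assms
proof (induction j arbitrary: b r)
  case (Suc j)
  have "act x (act g r) = 0"
    using Suc.prems(4) by (simp add: act_x_g)
  then have "expand a b r (g ^ i * x ^ j * x) = (if a = i \<and> b = Suc j then act (g ^ (i + Suc j)) r else 0)"
    unfolding expand_mult_x[OF Suc.prems(2)] using Suc
    by (cases b) (auto simp: expand_zero act_g_pow_g simp del: power_Suc)
  then show ?case by (simp add: mult.assoc power_Suc2 del: power_Suc)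
qed (simp add: expand_g_pow)

lemma expand_basis_top:
  assumes "i < n" "j < n"
  shows "expand i j r (g ^ i * x ^ j) = act (g ^ (i + j)) r"
  using assms(2)
proof (induction j arbitrary: r)
  case (Suc j)
  have "expand i (Suc j) r (g ^ i * x ^ j * x) = act (g ^ (i + Suc j)) r"
    unfolding expand_mult_x[OF Suc.prems] using Suc assms(1)
    by (simp add: expand_basis_upper act_g_pow_g del: power_Suc)
  then show ?case by (simp add: mult.assoc power_Suc2 del: power_Suc)
qed (use assms in \<open>simp add: expand_g_pow\<close>)

text \<open>Exactly one of the \<open>Suc j\<close> letters \<open>x\<close> acts on
  \<open>r\<close>. Moving it across the \<open>g\<close> produced by other letters gives one power
  of \<open>lam\<close> for each of its possible positions.\<close>

lemma expand_basis_subtop: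
  assumes "i < n" "j < n"
  shows "expand i j r (g ^ i * x ^ Suc j) =
    sR (\<Sum>t\<le>j. lam ^ t) (act (g ^ (i + j)) (act x r))"
  using assms(2)
proof (induction j arbitrary: r)
  case 0
  then show ?case
    using expand_mult_x[of 0 i r "g ^ i"] assms(1) by (simp add: expand_g_pow)
next
  case (Suc j)
  have "expand i (Suc j) r (g ^ i * x ^ Suc j * x) =
      sR (\<Sum>t\<le>j. lam ^ t) (act (g ^ (i + j)) (act x (act g r))) + act (g ^ (i + Suc j)) (act x r)"
    unfolding expand_mult_x[OF Suc.prems] using Suc assms(1)
    by (simp add: expand_basis_top del: power_Suc)
  also have "act (g ^ (i + j)) (act x (act g r)) = sR lam (act (g ^ (i + Suc j)) (act x r))"
    by (simp add: act_x_g act_scale act_g_pow_g del: power_Suc)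
  also have "sR (\<Sum>t\<le>j. lam ^ t) (sR lam (act (g ^ (i + Suc j)) (act x r))) +
      act (g ^ (i + Suc j)) (act x r) = sR (\<Sum>t\<le>Suc j. lam ^ t) (act (g ^ (i + Suc j)) (act x r))"
  proof -
    have "(\<Sum>t\<le>Suc j. lam ^ t) = (\<Sum>t\<le>j. lam ^ t) * lam + 1"
      by (subst sum.atMost_Suc_shift) (simp add: sum_distrib_left mult.commute[of _ lam] add.commute)
    then show ?thesis by (simp add: R.scale_left_distrib del: power_Suc)
  qed
  finally show ?case by (simp only: power_Suc2 mult.assoc)
qed

lemma q_number_nonzero:
  assumes "Suc j < n"
  shows "(\<Sum>t\<le>j. lam ^ t) \<noteq> 0"
proof
  assume "(\<Sum>t\<le>j. lam ^ t) = 0"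
  then have "lam ^ Suc j = 1"
    using sum_gp_basic[of lam j] by simp
  then show False using lam_pow_neq_1[of "Suc j"] assms by simp
qed

lemma expand_eq_sum:
  assumes "i < n" "j < n"
  shows "expand i j r h = (\<Sum>b<n. sR (coord i b h) (expand i j r (g ^ i * x ^ b)))"
proof -
  have sum: "expand i j r (sum f A) = (\<Sum>a\<in>A. expand i j r (f a))" for f :: "nat \<Rightarrow> 'h" and A
    using expand_scale[OF assms(2), of i r 0 0]
    by (induction A rule: infinite_finite_induct) (simp_all add: expand_add assms)
  have "expand i j r h = (\<Sum>a<n. \<Sum>b<n. sR (coord a b h) (expand i j r (g ^ a * x ^ b)))"
    by (subst taft_basis[of h]) (simp add: sum expand_scale assms)
  also have "\<dots> = (\<Sum>a<n. if a = i then (\<Sum>b<n. sR (coord a b h) (expand i j r (g ^ a * x ^ b))) else 0)"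
    using assms by (intro sum.cong refl) (auto simp: expand_basis_upper)
  also have "\<dots> = (\<Sum>b<n. sR (coord i b h) (expand i j r (g ^ i * x ^ b)))"
    using assms by simp
  finally show ?thesis .
qed

section \<open>Coefficients in \<open>R # H\<close> with respect to the
  \<open>g^i x^j\<close>\<close>

definition smash_coord :: "nat \<Rightarrow> nat \<Rightarrow> ('r \<times> 'h \<Rightarrow>\<^sub>0 'k) \<Rightarrow> 'r" where
  "smash_coord i j = lin_ext sR (\<lambda>(r, h). sR (coord i j h) r)"

text \<open>The coefficient of \<open>g\<^sup>i x\<^sup>j\<close> in \<open>(r # h) (r' # h')\<close>.\<close>

definition smash_coord_mult :: "nat \<Rightarrow> nat \<Rightarrow> 'r \<Rightarrow> 'h \<Rightarrow> 'r \<Rightarrow> 'h \<Rightarrow> 'r" where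
  "smash_coord_mult i j r h r' h' = sweedler sR (\<lambda>a b. sR (coord i j (b * h')) (r * act a r')) h"

lemma bilinear_coord:
  "j < n \<Longrightarrow> bilinear_map sR sH sR (\<lambda>r h. sR (coord i j h) r)"
  by (auto simp: bilinear_map_def coord_add coord_scale R.scale_left_distrib
      R.scale_right_distrib R.scale_left_commute mult.commute)

lemma smash_coord_rep_tcls:
  "j < n \<Longrightarrow> smash_coord i j (rep (tcls sR sH p)) = smash_coord i j p"
  unfolding smash_coord_def by (rule lin_ext_rep_tcls[OF R_vector_space bilinear_coord])

lemma smash_coord_add: "smash_coord i j (p + q) = smash_coord i j p + smash_coord i j q"
  by (simp add: smash_coord_def lin_ext_add R_vector_space)

lemma smash_coord_fscale: "smash_coord i j (fscale c p) = sR c (smash_coord i j p)"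
  by (simp add: smash_coord_def lin_ext_fscale R_vector_space)

lemma smash_coord_basis_vec: "smash_coord i j (basis_vec (r, h)) = sR (coord i j h) r"
  by (simp add: smash_coord_def R_vector_space)

lemma bilinear_smash_coord_mult_sweedler:
  assumes "j < n"
  shows "bilinear_map sH sH sR (\<lambda>a b. sR (coord i j (b * h')) (r * act a r'))"
  using assms
  by (auto simp: bilinear_map_def act_add_left act_scale_left coord_add coord_scale
      distrib_left distrib_right R.scale_left_distrib R.scale_right_distrib R.scale_left_commute
      mult.commute simp flip: R.scale_mult_right scale_mult_left)

lemma sweedler_scale_fun: "sweedler sR (\<lambda>a b. sR c (f a b)) h = sR c (sweedler sR f h)"
  using lin_ext_scale_fun[OF R_vector_space, of c "\<lambda>(a, b). f a b"]
  by (simp add: sweedler_def case_prod_unfold)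

lemma bilinear_smash_coord_mult_right:
  assumes "j < n"
  shows "bilinear_map sR sH sR (smash_coord_mult i j r h)"
  unfolding bilinear_map_def smash_coord_mult_def
  using assms
  by (auto simp: act_add act_scale coord_add coord_scale distrib_left
      R.scale_left_distrib R.scale_right_distrib sweedler_add_fun R_vector_space
      simp flip: R.scale_mult_right scale_mult_right sweedler_scale_fun
      simp: R.scale_left_commute mult.commute)

lemma bilinear_smash_coord_mult_left:
  assumes "j < n"
  shows "bilinear_map sR sH sR (\<lambda>r h. smash_coord_mult i j r h r' h')"
  unfolding bilinear_map_def smash_coord_mult_def
  using assms
  by (auto simp: sweedler_add[OF R_vector_space bilinear_smash_coord_mult_sweedler]
      sweedler_scale[OF R_vector_space bilinear_smash_coord_mult_sweedler]
      distrib_right R.scale_right_distrib sweedler_add_fun R_vector_space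
      simp flip: R.scale_mult_left sweedler_scale_fun
      simp: R.scale_left_commute mult.commute)

lemma smash_coord_smash_mult:
  assumes "j < n"
  shows "smash_coord i j (rep (smash_mult sH \<Delta> sR act P Q)) =
    lin_ext sR (\<lambda>(r, h). lin_ext sR (\<lambda>(r', h'). smash_coord_mult i j r h r' h') (rep Q)) (rep P)"
proof -
  have L: "smash_coord i j (lin_ext fscale f p) = lin_ext sR (\<lambda>k. smash_coord i j (f k)) p" for f and p :: "'c \<Rightarrow>\<^sub>0 'k"
    by (rule lin_ext_comp) (simp_all add: smash_coord_add smash_coord_fscale)
  show ?thesis
    unfolding smash_mult_def smash_coord_rep_tcls[OF assms]
    by (simp add: L case_prod_unfold smash_coord_basis_vec smash_coord_mult_def sweedler_def)
qed

lemma smash_coord_mult_tens: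
  assumes "j < n"
  shows "smash_coord i j (rep (smash_mult sH \<Delta> sR act P (tens sR sH r' h'))) =
    lin_ext sR (\<lambda>(r, h). smash_coord_mult i j r h r' h') (rep P)"
  by (simp add: smash_coord_smash_mult[OF assms]
      lin_ext_rep_tens[OF R_vector_space bilinear_smash_coord_mult_right[OF assms]])

lemma smash_coord_tens_mult:
  assumes "j < n"
  shows "smash_coord i j (rep (smash_mult sH \<Delta> sR act (tens sR sH r h) Q)) =
    lin_ext sR (\<lambda>(r', h'). smash_coord_mult i j r h r' h') (rep Q)"
proof -
  let ?f = "\<lambda>r h. lin_ext sR (\<lambda>(r', h'). smash_coord_mult i j r h r' h') (rep Q)"
  have "bilinear_map sR sH sR ?f"
  proof -
    have "smash_coord_mult i j (a + a') b r' h' =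
        smash_coord_mult i j a b r' h' + smash_coord_mult i j a' b r' h'"
      "smash_coord_mult i j a (b + b') r' h' =
        smash_coord_mult i j a b r' h' + smash_coord_mult i j a b' r' h'"
      "smash_coord_mult i j (sR c a) b r' h' = sR c (smash_coord_mult i j a b r' h')"
      "smash_coord_mult i j a (sH c b) r' h' = sR c (smash_coord_mult i j a b r' h')"
      for a a' b b' r' h' c
      using bilinear_smash_coord_mult_left[OF assms, of i r' h'] unfolding bilinear_map_def by blast+
    then show ?thesis
      by (simp add: bilinear_map_def case_prod_unfold lin_ext_add_fun R_vector_space
          lin_ext_scale_fun[OF R_vector_space])
  qed
  from lin_ext_rep_tens[OF R_vector_space this] show ?thesis
    by (simp add: smash_coord_smash_mult[OF assms])
qed

lemma smash_coord_mult_one_left: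
  assumes "j < n"
  shows "smash_coord_mult i j r 1 r' h' = sR (coord i j h') (r * r')"
  by (simp add: smash_coord_mult_def act_one
      sweedler_one[OF R_vector_space bilinear_smash_coord_mult_sweedler[OF assms]])

lemma smash_coord_mult_g_left:
  assumes "j < n"
  shows "smash_coord_mult i j 1 g r h = sR (coord i j (g * h)) (act g r)"
  unfolding smash_coord_mult_def
    sweedler_g[OF R_vector_space bilinear_smash_coord_mult_sweedler[OF assms]]
  by simp

lemma smash_coord_mult_x_left:
  assumes "j < n"
  shows "smash_coord_mult i j 1 x r h = sR (coord i j (x * h)) (act g r) + sR (coord i j h) (act x r)"
  unfolding smash_coord_mult_def
    sweedler_x[OF R_vector_space bilinear_smash_coord_mult_sweedler[OF assms]]
  by simp

lemma smash_coord_mult_expand: "smash_coord_mult i j r h r' 1 = r * expand i j r' h"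
  using sweedler_comp[of "\<lambda>y. r * y" sR sR "\<lambda>a b. sR (coord i j b) (act a r')" h]
  by (simp add: smash_coord_mult_def expand_def distrib_left R.scale_mult_right)

text \<open>On an invariant \<open>h1\<close> acts by its counit, and the counit law collapses the
  sum. With \<open>r' = 1\<close> this also describes right multiplication by \<open>g\<close> and
  by \<open>x\<close>.\<close>

lemma smash_coord_mult_invariant:
  assumes "j < n" "r' \<in> invariants \<epsilon> sR act"
  shows "smash_coord_mult i j r h r' k = sR (coord i j (h * k)) (r * r')"
proof -
  have inv: "act a r' = sR (\<epsilon> a) r'" for a
    using assms(2) by (simp add: invariants_def)
  have "sweedler sR (\<lambda>a b. sR (\<epsilon> a) (sR (coord i j (b * k)) (r * r'))) h = sR (coord i j (h * k)) (r * r')"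
    by (rule sweedler_counit_left)
      (simp_all add: assms(1) coord_add coord_scale distrib_right R.scale_left_distrib
        flip: scale_mult_left)
  then show ?thesis
    by (simp add: smash_coord_mult_def inv R.scale_left_commute mult.commute
       flip: R.scale_mult_right)
qed

lemma one_invariant: "1 \<in> invariants \<epsilon> sR act"
  by (simp add: invariants_def act_unit)

text \<open>The \<open>g^i x^j\<close> span \<open>R # H\<close> over \<open>R\<close>. The
  right-hand expression is linear in \<open>p\<close> only modulo the relators, so sums and scalars
  are compared up to \<open>tensor_null\<close>.\<close>

lemma tensor_normal_form:
  "tcls sR sH p = tcls sR sH (\<Sum>i<n. \<Sum>j<n. basis_vec (smash_coord i j p, g ^ i * x ^ j))"
proof -
  let ?N = "tensor_null sR sH"
  let ?F = "\<lambda>p. (\<Sum>i<n. \<Sum>j<n. basis_vec (smash_coord i j p, g ^ i * x ^ j))"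
  note N_add = fspace.subspace_add[OF tensor_null_subspace]
    and N_scale = fspace.subspace_scale[OF tensor_null_subspace]
    and N_sum = fspace.subspace_sum[OF tensor_null_subspace]
    and N_diff = fspace.subspace_diff[OF tensor_null_subspace]
  have F_add: "?F (p + q) - ?F p - ?F q \<in> ?N" for p q
    unfolding sum_subtractf[symmetric] smash_coord_add
    by (intro N_sum tensor_null_relators)
  have F_scale: "?F (fscale c p) - fscale c (?F p) \<in> ?N" for c p
    unfolding fspace.scale_sum_right sum_subtractf[symmetric] smash_coord_fscale
    by (intro N_sum tensor_null_relators)
  have basis: "basis_vec (r, h) - ?F (basis_vec (r, h)) \<in> ?N" for r h
  proof -
    have sum: "basis_vec (r, sum f A) - (\<Sum>a\<in>A. basis_vec (r, f a)) \<in> ?N" for f :: "nat \<Rightarrow> 'h" and A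
    proof (induction A rule: infinite_finite_induct)
      case (insert a A)
      show ?case
        using N_add[OF tensor_null_relators(2)[of r "f a" "sum f A"] insert.IH] insert.hyps
        by (simp add: algebra_simps)
    qed (use tensor_null_relators(4)[of r sH 0 0] in simp_all)
    let ?b = "\<lambda>i j. sH (coord i j h) (g ^ i * x ^ j)"
    \<comment> \<open>The sum of relators expands \<open>h\<close> over \<open>i\<close>, then over
      \<open>j\<close>, and finally moves the scalar \<open>coord i j h\<close> from
      \<open>H\<close> to \<open>R\<close>.\<close>
    have "basis_vec (r, \<Sum>i<n. \<Sum>j<n. ?b i j) - (\<Sum>i<n. basis_vec (r, \<Sum>j<n. ?b i j)) +
       (\<Sum>i<n. basis_vec (r, \<Sum>j<n. ?b i j) - (\<Sum>j<n. basis_vec (r, ?b i j))) +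
       (\<Sum>i<n. \<Sum>j<n. basis_vec (r, ?b i j) - fscale (coord i j h) (basis_vec (r, g ^ i * x ^ j))) -
       (\<Sum>i<n. \<Sum>j<n. basis_vec (sR (coord i j h) r, g ^ i * x ^ j) -
          fscale (coord i j h) (basis_vec (r, g ^ i * x ^ j))) \<in> ?N"
      by (intro N_add N_diff N_sum sum tensor_null_relators)
    then show ?thesis
      unfolding taft_basis[of h, symmetric] by (simp add: smash_coord_basis_vec sum_subtractf)
  qed
  have "p - ?F p \<in> ?N"
  proof -
    let ?P = "{p. p - ?F p \<in> ?N}"
    \<comment> \<open>\<open>p\<close> is the linear extension of the basis inclusion evaluated at
      itself, which gives an induction over formal sums.\<close>
    have "lin_ext fscale basis_vec p \<in> ?P"
    proof (rule lin_ext_in_subspace)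
      fix p q assume "p \<in> ?P" "q \<in> ?P"
      then have "(p - ?F p) + (q - ?F q) - (?F (p + q) - ?F p - ?F q) \<in> ?N"
        by (intro N_diff[OF N_add F_add]) simp_all
      then show "p + q \<in> ?P" by (simp add: algebra_simps)
    next
      fix c p assume "p \<in> ?P"
      then have "fscale c (p - ?F p) - (?F (fscale c p) - fscale c (?F p)) \<in> ?N"
        by (intro N_diff[OF N_scale F_scale]) simp_all
      then show "fscale c p \<in> ?P" by (simp add: fspace.scale_right_diff_distrib)
    next
      show "0 \<in> ?P" using basis[of 0 0] F_scale[of 0 0]
        using fspace.subspace_neg[OF tensor_null_subspace] by simp
    qed (use basis in auto)
    moreover have "lin_ext fscale basis_vec p = p"
      by (rule poly_mapping_eqI) (simp add: lin_ext_def lookup_sum lookup_single when_def in_keys_iff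
          if_distrib[of "(*) _"] cong: if_cong)
    ultimately show ?thesis by simp
  qed
  then show ?thesis by (simp add: tcls_eq_iff)
qed

lemma tensor_eqI:
  assumes "P \<in> tensor sR sH" "Q \<in> tensor sR sH"
    and "\<And>i j. i < n \<Longrightarrow> j < n \<Longrightarrow> smash_coord i j (rep P) = smash_coord i j (rep Q)"
  shows "P = Q"
proof -
  have "tcls sR sH (rep P) = tcls sR sH (rep Q)"
    by (subst (1 2) tensor_normal_form) (simp add: assms(3))
  then show ?thesis by (simp add: tcls_rep assms(1,2))
qed

section \<open>Central elements\<close>

text \<open>Written with \<open>(n - 1) m\<close> because the twist is by \<open>g\<^sup>k\<^sup>-\<^sup>m\<close> and \<open>g\<close> has order \<open>n\<close>.\<close>

lemma twisted_commutation_x: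
  assumes "\<And>d. act x d = 0 \<Longrightarrow> d * r = r * act (g ^ k) d"
  shows "act x d = 0 \<Longrightarrow> d * act (x ^ m) r = act (x ^ m) r * act (g ^ (k + (n - 1) * m)) d"
proof (induction m arbitrary: d)
  case (Suc m)
  \<comment> \<open>Applying \<open>x\<close> to \<open>d' y\<close> yields
    \<open>g(d') x(y)\<close> because \<open>x(d') = 0\<close>, so \<open>d'\<close> has to be the
    preimage of \<open>d\<close> under \<open>g\<close>.\<close>
  define d' where "d' = act (g ^ (n - 1)) d"
  let ?y = "act (x ^ m) r" and ?e = "k + (n - 1) * m"
  have g_d: "act g d' = d"
  proof -
    have "g * g ^ (n - 1) = g ^ n" using n_gt_1 by (simp flip: power_Suc)
    then show ?thesis by (simp add: d'_def g_pow_n act_one flip: act_mult)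
  qed
  have x_d: "act x d' = 0"
    by (simp add: d'_def act_x_g_pow Suc.prems)
  have "act x (act (g ^ ?e) d') = 0"
    by (subst act_x_g_pow) (simp only: x_d act_zero R.scale_zero_right)
  then have "d * act x ?y = act x ?y * act (g ^ ?e) d'"
    using arg_cong[OF Suc.IH[OF x_d], of "act x"] by (simp add: act_x_mult x_d g_d)
  moreover have "act (g ^ ?e) d' = act (g ^ (k + (n - 1) * Suc m)) d"
  proof -
    have "k + (n - 1) * Suc m = ?e + (n - 1)" by simp
    then show ?thesis by (simp only: d'_def act_mult power_add)
  qed
  ultimately show ?case
    by (simp only: act_mult power_Suc)
qed (use assms in \<open>simp add: act_one\<close>)

lemma nilpotency_index_of_twisted:
  assumes not_inner: "\<And>i. 0 < i \<Longrightarrow> i < n \<Longrightarrow> \<not> X_inner {r. act x r = 0} (act (g ^ i))"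
    and "r \<noteq> 0" and twisted: "\<And>d. act x d = 0 \<Longrightarrow> d * r = r * act (g ^ k) d"
  shows "act (x ^ (k mod n)) r \<noteq> 0"
proof -
  have "act 0 r = 0"
    using act_add_left[of 0 0 r] by simp
  \<comment> \<open>\<open>x ^ m\<close> is the last power before \<open>r\<close> is killed; it
    exists because \<open>x ^ n = 0\<close>.\<close>
  then obtain m where m: "m < n" "act (x ^ m) r \<noteq> 0" "act (x ^ Suc m) r = 0"
    using ex_least_nat_less[of "\<lambda>m. act (x ^ m) r = 0" n] \<open>r \<noteq> 0\<close>
    by (auto simp: x_pow_n act_one)
  let ?e = "k + (n - 1) * m"
  have "X_inner {r. act x r = 0} (act (g ^ (?e mod n)))"
    unfolding X_inner_def
    using m twisted_commutation_x[OF twisted]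
    by (intro bexI[of _ "act (x ^ m) r"]) (auto simp: act_g_pow_mod act_mult)
  then have "?e mod n = 0"
    using not_inner[of "?e mod n"] n_gt_1 by fastforce
  \<comment> \<open>Thus \<open>?e\<close> is congruent to \<open>k - m\<close>, and its vanishing
    modulo \<open>n\<close> makes \<open>m\<close> the residue of \<open>k\<close>.\<close>
  moreover have "(k + (n - 1) * m) + m = k + n * m"
    using n_gt_1 by (cases n) simp_all
  ultimately have "k mod n = m"
    using m(1) by (metis add_0 mod_add_left_eq mod_less mod_mult_self2)
  then show ?thesis using m by simp
qed

lemma act_x_nonzero:
  assumes "inner_faithful sH \<Delta> \<epsilon> S act"
  obtains r where "act x r \<noteq> 0"
proof (rule ccontr)
  assume "\<not> thesis"
  then have "act x r = 0" for r using that by blast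
  then have "range (\<lambda>h. h * x) = {0}"
    using assms hopf_ideal_x by (auto simp: inner_faithful_def act_mult)
  then show False
    using x_nonzero by (metis mult_1 rangeI singletonD)
qed

lemma act_g_pow_eq_0: "act (g ^ m) r = 0 \<Longrightarrow> r = 0"
proof -
  assume "act (g ^ m) r = 0"
  then have "act (g ^ (n * m - m) * g ^ m) r = 0"
    by (simp add: act_mult)
  then show "r = 0"
    using n_gt_1 by (simp add: power_mult g_pow_n act_one flip: power_add)
qed

text \<open>\<epsilon> is multiplicative, so acting through \<epsilon> passes from the two
  generators to all words.\<close>

lemma invariantI:
  assumes "act g r = r" "act x r = 0"
  shows "r \<in> invariants \<epsilon> sR act"
proof -
  have "act h r = sR (\<epsilon> h) r" for h
  proof (induction h rule: taft_induct)
    case (word w)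
    show ?case
    proof (induction w rule: inversions.induct)
      case (2 w)
      then show ?case by (simp add: act_mult act_scale assms counit_mult counit_g)
    next
      case (3 w)
      then show ?case by (simp add: act_mult act_scale assms counit_mult counit_x)
    qed (simp add: act_one counit_one)
  qed (simp_all add: act_add_left act_scale_left counit_add counit_scale R.scale_left_distrib)
  then show ?thesis by (simp add: invariants_def)
qed

section \<open>Coefficients of a central element\<close>

context
  fixes z
  assumes z_tensor: "z \<in> tensor sR sH"
    and z_central: "\<And>w. w \<in> tensor sR sH \<Longrightarrow>
      smash_mult sH \<Delta> sR act z w = smash_mult sH \<Delta> sR act w z"
begin

abbreviation z_coord :: "nat \<Rightarrow> nat \<Rightarrow> 'r" where
  "z_coord i j \<equiv> smash_coord i j (rep z)"

lemma z_coord_comp: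
  assumes "\<And>a b. L (a + b) = L a + L b" "\<And>c a. L (sR c a) = sR c (L a)"
  shows "L (z_coord i j) = lin_ext sR (\<lambda>(r, h). sR (coord i j h) (L r)) (rep z)"
  unfolding smash_coord_def
  by (subst lin_ext_comp[of L sR sR]) (simp_all add: assms case_prod_unfold)

lemma z_central_coord:
  assumes "j < n"
  shows "lin_ext sR (\<lambda>(r', h'). smash_coord_mult i j r h r' h') (rep z) =
    lin_ext sR (\<lambda>(r', h'). smash_coord_mult i j r' h' r h) (rep z)"
  using z_central[OF tcls_in_tensor, of "basis_vec (r, h)"]
    smash_coord_tens_mult[OF assms] smash_coord_mult_tens[OF assms] by metis

lemma z_commutes_R:
  assumes "i < n" "j < n"
  shows "r * z_coord i j = (\<Sum>b<n. z_coord i b * expand i j r (g ^ i * x ^ b))"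
proof -
  have "r * z_coord i j = lin_ext sR (\<lambda>(r', h'). smash_coord_mult i j r 1 r' h') (rep z)"
    using z_coord_comp[of "\<lambda>y. r * y" i j] assms
    by (simp add: distrib_left R.scale_mult_right smash_coord_mult_one_left)
  also have "\<dots> = lin_ext sR (\<lambda>(r', h'). r' * expand i j r h') (rep z)"
    by (simp add: z_central_coord assms smash_coord_mult_expand)
  also have "\<dots> = lin_ext sR (\<lambda>p. \<Sum>b<n. case p of (r', h') \<Rightarrow>
      sR (coord i b h') (r' * expand i j r (g ^ i * x ^ b))) (rep z)"
    by (subst expand_eq_sum[OF assms])
      (simp add: sum_distrib_left case_prod_unfold flip: R.scale_mult_right)
  also have "\<dots> = (\<Sum>b<n. z_coord i b * expand i j r (g ^ i * x ^ b))"
    by (simp add: lin_ext_sum_fun R_vector_space z_coord_comp[of "\<lambda>y. y * _"] distrib_right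
        R.scale_mult_left)
  finally show ?thesis .
qed

lemma z_commutes_g:
  assumes "i < n" "j < n"
  shows "act g (z_coord i j) = sR (lam ^ j) (z_coord i j)"
proof -
  \<comment> \<open>The coefficients of \<open>g z\<close> and \<open>z g\<close> are compared at
    \<open>g^(i+1) x^j\<close>, the exponent of \<open>g\<close> taken modulo
    \<open>n\<close>.\<close>
  have "act g (z_coord i j) = lin_ext sR (\<lambda>(r, h). smash_coord_mult (Suc i mod n) j 1 g r h) (rep z)"
    using z_coord_comp[of "act g" i j] assms
    by (simp add: act_add act_scale smash_coord_mult_g_left coord_g_mult)
  also have "\<dots> = lin_ext sR (\<lambda>(r, h). sR (coord i j h) (sR (lam ^ j) r)) (rep z)"
    using assms
    by (simp add: z_central_coord smash_coord_mult_invariant one_invariant coord_mult_g mult.commute)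
  also have "\<dots> = sR (lam ^ j) (z_coord i j)"
    using z_coord_comp[of "sR (lam ^ j)" i j]
    by (simp add: R.scale_right_distrib R.scale_left_commute mult.commute)
  finally show ?thesis .
qed

text \<open>Compares the coefficients of \<open>g^i x^j\<close> in \<open>z x\<close> and
  \<open>x z\<close>. For \<open>j = 0\<close> the terms raised by the extra \<open>x\<close> are
  absent.\<close>

lemma z_commutes_x:
  assumes "i < n" "j < n"
  shows "(if j = 0 then 0 else z_coord i (j - 1)) =
    (if j = 0 then 0 else sR (lam ^ i) (act g (z_coord i (j - 1)))) + act x (z_coord i j)"
proof -
  have zero: "lin_ext sR (\<lambda>(r, h). 0) (rep z) = 0"
    by (simp add: lin_ext_def case_prod_unfold)
  have "(if j = 0 then 0 else z_coord i (j - 1)) =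
      lin_ext sR (\<lambda>(r, h). smash_coord_mult i j r h 1 x) (rep z)"
    using assms
    by (simp add: smash_coord_mult_invariant one_invariant coord_mult_x smash_coord_def zero)
  also have "\<dots> = lin_ext sR (\<lambda>(r, h). smash_coord_mult i j 1 x r h) (rep z)"
    by (simp add: z_central_coord assms)
  also have "\<dots> = lin_ext sR (\<lambda>(r, h). sR (coord i j (x * h)) (act g r)) (rep z) +
      lin_ext sR (\<lambda>(r, h). sR (coord i j h) (act x r)) (rep z)"
    using assms
    by (simp add: smash_coord_mult_x_left case_prod_unfold lin_ext_add_fun R_vector_space)
  also have "lin_ext sR (\<lambda>(r, h). sR (coord i j (x * h)) (act g r)) (rep z) =
      (if j = 0 then 0 else sR (lam ^ i) (act g (z_coord i (j - 1))))"
    using assms z_coord_comp[of "\<lambda>y. sR (lam ^ i) (act g y)" i "j - 1"]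
    by (simp add: coord_x_mult zero act_add act_scale R.scale_right_distrib R.scale_left_commute
        mult.commute)
  also have "lin_ext sR (\<lambda>(r, h). sR (coord i j h) (act x r)) (rep z) = act x (z_coord i j)"
    by (simp add: z_coord_comp act_add act_scale)
  finally show ?thesis .
qed

lemma act_x_z_coord_0: "i < n \<Longrightarrow> act x (z_coord i 0) = 0"
  using z_commutes_x[of i 0] n_gt_1 by simp

text \<open>The factor \<open>lam ^ i\<close> comes from moving \<open>x\<close> past
  \<open>g ^ i\<close>, and \<open>lam ^ j\<close> is the eigenvalue of \<open>g\<close> on
  \<open>z_coord i j\<close>.\<close>

lemma act_x_z_coord_Suc:
  assumes "i < n" "Suc j < n"
  shows "act x (z_coord i (Suc j)) = sR (1 - lam ^ (i + j)) (z_coord i j)"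
  using z_commutes_x[of i "Suc j"] z_commutes_g[of i j] assms
  by (simp add: power_add R.scale_left_diff_distrib algebra_simps)

lemma act_x_pow_z_coord:
  assumes "i < n" "j < n" "t \<le> j"
  shows "\<exists>c. act (x ^ t) (z_coord i j) = sR c (z_coord i (j - t))"
  using assms(3)
proof (induction t)
  case 0
  show ?case by (rule exI[of _ 1]) (simp add: act_one)
next
  case (Suc t)
  then obtain c where c: "act (x ^ t) (z_coord i j) = sR c (z_coord i (j - t))" by auto
  have "Suc (j - Suc t) = j - t" "j - t < n" using Suc.prems assms by auto
  then show ?case
    using act_x_z_coord_Suc[of i "j - Suc t"] assms(1) by (auto simp: act_mult c act_scale)
qed

lemma z_coord_twisted:
  assumes "i < n" "j < n" "act x d = 0"
  shows "d * z_coord i j = z_coord i j * act (g ^ (i + j)) d"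
proof -
  have "d * z_coord i j = (\<Sum>b<n. if b = j then z_coord i b * act (g ^ (i + b)) d else 0)"
    unfolding z_commutes_R[OF assms(1,2)]
    by (intro sum.cong refl) (simp add: expand_basis_x_kernel assms)
  then show ?thesis using assms by simp
qed

section \<open>Vanishing of the coefficients\<close>

context
  assumes not_inner: "\<And>i. 0 < i \<Longrightarrow> i < n \<Longrightarrow> \<not> X_inner {r. act x r = 0} (act (g ^ i))"
begin

text \<open>If \<open>x ^ m\<close> killed the coefficient, so would the higher power singled out by
  the twist.\<close>

lemma act_x_pow_z_coord_nonzero:
  assumes "i < n" "j < n" "z_coord i j \<noteq> 0" "m \<le> (i + j) mod n"
  shows "act (x ^ m) (z_coord i j) \<noteq> 0"
proof
  assume "act (x ^ m) (z_coord i j) = 0"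
  then have "act (x ^ ((i + j) mod n - m) * x ^ m) (z_coord i j) = 0"
    by (simp add: act_mult)
  moreover have "act (x ^ ((i + j) mod n)) (z_coord i j) \<noteq> 0"
    using nilpotency_index_of_twisted[OF not_inner assms(3)] z_coord_twisted assms by blast
  ultimately show False
    using assms(4) by (simp flip: power_add)
qed

lemma z_coord_eq_0:
  assumes "i < n" "j < n" "i + j \<noteq> 0" "i + j \<noteq> n"
  shows "z_coord i j = 0"
proof (rule ccontr)
  assume nz: "z_coord i j \<noteq> 0"
  note nonzero = act_x_pow_z_coord_nonzero[OF assms(1,2) nz]
  \<comment> \<open>Step \<open>Suc t\<close> of the recursion multiplies by
    \<open>1 - lam ^ (i + j - Suc t)\<close>. If this is \<open>0\<close>, then
    \<open>x ^ Suc t\<close> kills the coefficient, although \<open>Suc t\<close> does not exceed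
    the residue of \<open>i + j\<close>.\<close>
  have unit: False if t: "t < j" "Suc t \<le> (i + j) mod n" "lam ^ (i + j - Suc t) = 1" for t
  proof -
    obtain c where c: "act (x ^ t) (z_coord i j) = sR c (z_coord i (j - t))"
      using act_x_pow_z_coord[OF assms(1,2), of t] t(1) by auto
    have "Suc (j - Suc t) = j - t" "j - t < n" "i + (j - Suc t) = i + j - Suc t"
      using t assms by auto
    then have "act (x ^ Suc t) (z_coord i j) = 0"
      using act_x_z_coord_Suc[of i "j - Suc t"] assms(1) t(3)
      by (simp add: act_mult c act_scale)
    then show False using nonzero t(2) by blast
  qed
  consider "i = 0" "0 < j" | "0 < i" "i + j < n" | "n < i + j"
    using assms by linarith
  then show False
  proof cases
    case 1
    \<comment> \<open>The exponent of \<open>lam\<close> is \<open>0\<close> at the last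
      step.\<close>
    then show False using unit[of "j - 1"] assms by simp
  next
    case 2
    \<comment> \<open>After \<open>j\<close> steps a multiple of \<open>z_coord i 0\<close> is
      reached, which \<open>x\<close> kills, whereas the residue \<open>i + j\<close> is at least
      \<open>j + 1\<close>.\<close>
    obtain c where c: "act (x ^ j) (z_coord i j) = sR c (z_coord i 0)"
      using act_x_pow_z_coord[OF assms(1,2), of j] by auto
    have "act (x ^ Suc j) (z_coord i j) = 0"
      using act_x_z_coord_0 assms(1) by (simp add: act_mult c act_scale)
    then show False using nonzero[of "Suc j"] 2 by simp
  next
    case 3
    \<comment> \<open>Here the residue is \<open>i + j - n\<close>, and at the step reaching it the
      exponent of \<open>lam\<close> is exactly \<open>n\<close>.\<close>
    then have "(i + j) mod n = i + j - n"
      using assms by (simp add: mod_if)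
    moreover have "i + j - n - 1 < j" "Suc (i + j - n - 1) = i + j - n" "i + j - (i + j - n) = n"
      using 3 assms by linarith+
    ultimately show False
      using unit[of "i + j - n - 1"] by (metis lam_pow_n order_refl)
  qed
qed

lemma z_coord_antidiagonal_eq_0:
  assumes "inner_faithful sH \<Delta> \<epsilon> S act" and "i < n" "j < n" "i + j = n"
  shows "z_coord i j = 0"
proof -
  obtain k where k: "j = Suc k" using assms by (cases j) auto
  obtain r where r: "act x r \<noteq> 0" using act_x_nonzero assms(1) by blast
  \<comment> \<open>Since \<open>i > 0\<close>, every coefficient in row \<open>i\<close> other than
    \<open>z_coord i j\<close> is already known to vanish.\<close>
  have "(\<Sum>b<n. z_coord i b * expand i k r (g ^ i * x ^ b)) =
      (\<Sum>b<n. if b = j then z_coord i b * expand i k r (g ^ i * x ^ b) else 0)"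
    using assms by (intro sum.cong refl) (auto simp: z_coord_eq_0)
  also have "\<dots> = z_coord i j * sR (\<Sum>t\<le>k. lam ^ t) (act (g ^ (i + k)) (act x r))"
    using assms k expand_basis_subtop[of i k] by simp
  finally have "z_coord i j * sR (\<Sum>t\<le>k. lam ^ t) (act (g ^ (i + k)) (act x r)) = r * z_coord i k"
    using z_commutes_R[of i k r] assms k by simp
  \<comment> \<open>\<open>i + k = n - 1\<close> is neither \<open>0\<close> nor
    \<open>n\<close>.\<close>
  also have "z_coord i k = 0"
    using assms k by (intro z_coord_eq_0) auto
  finally have "z_coord i j * sR (\<Sum>t\<le>k. lam ^ t) (act (g ^ (i + k)) (act x r)) = 0"
    by simp
  then show ?thesis
    using q_number_nonzero[of k] act_g_pow_eq_0[of "i + k" "act x r"] r assms(3) k by auto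
qed

lemma central_element:
  assumes "inner_faithful sH \<Delta> \<epsilon> S act"
  shows "z \<in> (\<lambda>r. tens sR sH r 1) ` (center_of UNIV (*) \<inter> invariants \<epsilon> sR act)"
proof -
  have vanish: "z_coord i j = 0" if "i < n" "j < n" "i \<noteq> 0 \<or> j \<noteq> 0" for i j
    using z_coord_eq_0[of i j] z_coord_antidiagonal_eq_0[OF assms, of i j] that by fastforce
  let ?r = "z_coord 0 0"
  have "z = tens sR sH ?r 1"
    by (rule tensor_eqI[OF z_tensor tcls_in_tensor])
      (auto simp: smash_coord_rep_tcls smash_coord_basis_vec coord_one vanish)
  moreover have "?r \<in> invariants \<epsilon> sR act"
    using z_commutes_g[of 0 0] act_x_z_coord_0[of 0] n_gt_1 by (intro invariantI) simp_all
  moreover have "?r * r = r * ?r" for r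
  proof -
    have "r * ?r = (\<Sum>b<n. if b = 0 then z_coord 0 b * expand 0 0 r (g ^ 0 * x ^ b) else 0)"
      unfolding z_commutes_R[OF order.strict_trans[OF zero_less_one n_gt_1]
          order.strict_trans[OF zero_less_one n_gt_1]]
      using n_gt_1 by (intro sum.cong refl) (auto simp: vanish)
    also have "\<dots> = ?r * r"
      using n_gt_1 expand_basis_top[of 0 0 r] by (simp add: act_one)
    finally show ?thesis ..
  qed
  ultimately show ?thesis
    by (auto simp: center_of_def)
qed

end

end

text \<open>The converse inclusion: invariance lets \<open>r\<close> pass the elements of
  \<open>H\<close> untwisted, and centrality in \<open>R\<close> lets it pass the
  coefficients.\<close>

lemma invariant_central:
  assumes "r \<in> center_of UNIV (*)" "r \<in> invariants \<epsilon> sR act"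
  shows "tens sR sH r 1 \<in> center_of (tensor sR sH) (smash_mult sH \<Delta> sR act)"
proof -
  have comm: "r * r' = r' * r" for r'
    using assms(1) by (simp add: center_of_def)
  have "smash_mult sH \<Delta> sR act (tens sR sH r 1) w = smash_mult sH \<Delta> sR act w (tens sR sH r 1)" for w
  proof (rule tensor_eqI)
    fix i j assume "i < n" "j < n"
    then show "smash_coord i j (rep (smash_mult sH \<Delta> sR act (tens sR sH r 1) w)) =
        smash_coord i j (rep (smash_mult sH \<Delta> sR act w (tens sR sH r 1)))"
      by (simp add: smash_coord_tens_mult smash_coord_mult_tens smash_coord_mult_one_left
          smash_coord_mult_invariant assms(2) comm)
  qed (simp_all add: smash_mult_def tcls_in_tensor)
  then show ?thesis
    by (simp add: center_of_def tcls_in_tensor)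
qed

end

theorem theorem1:
  fixes n :: nat
    and lam :: "'k::{alg_closed_field, field_char_0}"
    and sH :: "'k \<Rightarrow> 'h::ring_1 \<Rightarrow> 'h"
    and \<Delta> :: "'h \<Rightarrow> ('h \<times> 'h \<Rightarrow>\<^sub>0 'k) set"
    and \<epsilon> :: "'h \<Rightarrow> 'k"
    and S :: "'h \<Rightarrow> 'h"
    and g x :: 'h
    and sR :: "'k \<Rightarrow> 'r::ring_1_no_zero_divisors \<Rightarrow> 'r"
    and act :: "'h \<Rightarrow> 'r \<Rightarrow> 'r"
  assumes "n > 1"
    and "primitive_root n lam"
    and "taft_algebra n lam sH \<Delta> \<epsilon> S g x"
    and "module_algebra sH \<Delta> \<epsilon> S sR act"
    and "inner_faithful sH \<Delta> \<epsilon> S act"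
    and "\<And>i. 0 < i \<Longrightarrow> i < n \<Longrightarrow> \<not> X_inner {r. act x r = 0} (act (g ^ i))"
  shows "center_of (tensor sR sH) (smash_mult sH \<Delta> sR act) =
    (\<lambda>r. tens sR sH r 1) ` (center_of UNIV (*) \<inter> invariants \<epsilon> sR act)"
proof -
  interpret taft_action n lam sH \<Delta> \<epsilon> S g x sR act
    using assms(1-4) by (intro taft_action.intro taft_root.intro taft_root_axioms.intro)
  show ?thesis
    using central_element[OF _ _ assms(6,5)] invariant_central
    by (auto simp: center_of_def[of "tensor sR sH"])
qed

end
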